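(* Let $\mathcal{B}$ be a unital Banach algebra, let $T_1,T_2\in\mathcal{B}$, and let $n\geqslant 1$ be an integer such that $T_1^{(n)}\sim T_2^{(n)}$ in $\mathbb{M}_n(\mathcal{B})$. If $T_1$ has essentially finite-dimensional commutant in $\mathcal{B}$, then $T_1\sim T_2$ in $\mathcal{B}$.
   Context: Banach algebras are over $\mathbb{C}$. $T^{(n)}\in\mathbb{M}_n(\mathcal{B})$ is the diagonal matrix all of whose diagonal entries are $T$. For elements $A,B$ of a unital algebra $\mathcal{N}$, $A\sim B$ in $\mathcal{N}$ means $B=X^{-1}AX$ for some invertible $X\in\mathcal{N}$. For $T\in\mathcal{B}$ put $(T,\mathcal{B})'=\{X\in\mathcal{B}\colon TX=XT\}$ (relative commutant) and $\mathcal{Q}(T,\mathcal{B})=(T,\mathcal{B})'/\mathrm{Rad}((T,\mathcal{B})')$, where $\mathrm{Rad}$ is the Jacobson radical. $T$ has essentially finite-dimensional commutant in $\mathcal{B}$ if $\mathcal{Q}(T,\mathcal{B})$ is finite dimensional. *)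

theory Defs
  imports
    "HOL-Analysis.Analysis"
    "HOL-Algebra.Embedded_Algebras"
    "Jordan_Normal_Form.VS_Connect"
begin

text \<open>
  Complex unital Banach algebras. The real scalar multiplication, the norm and completeness come
  from the library; a complex scalar multiplication compatible with them is added. The equation
  \<open>norm 1 = 1\<close> is not required.
\<close>

class unital_banach_algebra = real_algebra_1 + real_normed_algebra + banach +
  fixes scaleC :: "complex \<Rightarrow> 'a \<Rightarrow> 'a" (infixr \<open>*\<^sub>C\<close> 75)
  assumes scaleC_add_right: "c *\<^sub>C (x + y) = c *\<^sub>C x + c *\<^sub>C y"
    and scaleC_add_left: "(c + d) *\<^sub>C x = c *\<^sub>C x + d *\<^sub>C x"
    and scaleC_scaleC: "c *\<^sub>C d *\<^sub>C x = (c * d) *\<^sub>C x"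
    and scaleR_scaleC: "r *\<^sub>R x = complex_of_real r *\<^sub>C x"
    and mult_scaleC_left: "(c *\<^sub>C x) * y = c *\<^sub>C (x * y)"
    and mult_scaleC_right: "x * (c *\<^sub>C y) = c *\<^sub>C (x * y)"
    and norm_scaleC: "norm (c *\<^sub>C x) = cmod c * norm x"

definition similar_in :: "('a, 'b) monoid_scheme \<Rightarrow> 'a \<Rightarrow> 'a \<Rightarrow> bool" where
  "similar_in N A B \<longleftrightarrow>
     A \<in> carrier N \<and> B \<in> carrier N \<and>
     (\<exists>X\<in>Units N. B = inv\<^bsub>N\<^esub> X \<otimes>\<^bsub>N\<^esub> A \<otimes>\<^bsub>N\<^esub> X)"

text \<open>
  The Jacobson radical of a (not necessarily commutative) unital ring, as the intersection of its
  maximal left ideals; for the zero ring, which has none, it is the whole ring.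
\<close>

definition left_ideal :: "'a set \<Rightarrow> ('a, 'b) ring_scheme \<Rightarrow> bool" where
  "left_ideal I R \<longleftrightarrow>
     additive_subgroup I R \<and> (\<forall>r\<in>carrier R. \<forall>x\<in>I. r \<otimes>\<^bsub>R\<^esub> x \<in> I)"

definition maximal_left_ideal :: "'a set \<Rightarrow> ('a, 'b) ring_scheme \<Rightarrow> bool" where
  "maximal_left_ideal I R \<longleftrightarrow>
     left_ideal I R \<and> I \<noteq> carrier R \<and>
     (\<forall>J. left_ideal J R \<longrightarrow> I \<subseteq> J \<longrightarrow> J = I \<or> J = carrier R)"

definition jacobson_radical :: "('a, 'b) ring_scheme \<Rightarrow> 'a set" where
  "jacobson_radical R = {x \<in> carrier R. \<forall>I. maximal_left_ideal I R \<longrightarrow> x \<in> I}"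

definition relative_commutant :: "'a::ring_1 \<Rightarrow> 'a ring" where
  "relative_commutant T = class_ring\<lparr>carrier := {X. T * X = X * T}\<rparr>"

definition commutant_quotient :: "'a::ring_1 \<Rightarrow> 'a set ring" where
  "commutant_quotient T =
     relative_commutant T Quot jacobson_radical (relative_commutant T)"

text \<open>
  The library measures dimension over a subfield of the ring, acting by left multiplication. Here
  this is the copy of the complex numbers formed by the classes of the scalar multiples of \<open>1\<close>:
  multiplying by the class of \<open>c *\<^sub>C 1\<close> is multiplying by the scalar \<open>c\<close>.
\<close>

definition quotient_scalars :: "'a::unital_banach_algebra \<Rightarrow> 'a set set" where
  "quotient_scalars T =
     range (\<lambda>c. jacobson_radical (relative_commutant T) +>\<^bsub>relative_commutant T\<^esub> (c *\<^sub>C 1))"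

definition ess_finite_dim_commutant :: "'a::unital_banach_algebra \<Rightarrow> bool" where
  "ess_finite_dim_commutant T \<longleftrightarrow>
     ring.finite_dimension (commutant_quotient T) (quotient_scalars T)
       (carrier (commutant_quotient T))"

end

theory Submission
  imports Defs
begin

text \<open>
  Write \<open>I(S, T)\<close> for the set of \<open>x\<close> with \<open>S x = x T\<close>. Then \<open>A = I(T\<^sub>1, T\<^sub>1)\<close> is the commutant of
  \<open>T\<^sub>1\<close>, and \<open>H = I(T\<^sub>1, T\<^sub>2)\<close> is a left \<open>A\<close>-module; \<open>T\<^sub>1\<close> and \<open>T\<^sub>2\<close> are similar exactly if \<open>H\<close> contains
  an invertible element. The entries of the matrix that conjugates the two amplifications lie in \<open>H\<close>,
  those of its inverse lie in \<open>K = I(T\<^sub>2, T\<^sub>1)\<close>, and together they amount to an isomorphism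
  \<open>H\<^sup>n \<cong> A\<^sup>n\<close> of \<open>A\<close>-modules. So the theorem is an instance of the extraction of \<open>n\<close>-th roots for
  finitely generated projective modules over a ring \<open>A\<close> with \<open>A / J\<close> semisimple, where \<open>J\<close> is the
  radical of \<open>A\<close>: one passes to \<open>A / J\<close>, where the claim \<open>H / J H \<cong> A / J\<close> follows by counting
  simple constituents, and lifts the result along \<open>J\<close>.

  The proof below avoids the structure theory of semisimple rings. Finite dimensionality of \<open>A / J\<close> is
  used only through a bounded, strictly monotone length on the left ideals above \<open>J\<close>, which
  extends to submodules of \<open>A\<^sup>n\<close> that contain \<open>J\<^sup>n\<close> (\<open>row_length\<close>). For \<open>z \<in> H\<close>, the map
  \<open>A\<^sup>n \<rightarrow> H\<^sup>n \<cong> A\<^sup>n\<close>, right multiplication by \<open>z\<close> followed by the isomorphism, is an endomorphism of a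
  module of finite length modulo \<open>J\<close>. Choose \<open>z\<close> such that \<open>A z + J H\<close> is as large as possible.

  If the annihilator of \<open>z\<close> modulo \<open>J H\<close> were larger than \<open>J\<close>, it would contain an idempotent \<open>e\<close> modulo
  \<open>J\<close> with \<open>e \<notin> J\<close> (\<open>exists_idempotent_mod_radical\<close>). If \<open>e H\<close> were contained in \<open>A z + J H\<close>, the
  endomorphism of \<open>z\<close> would be surjective on \<open>e A\<^sup>n\<close> while it kills \<open>(e, ..., e)\<close>, which is
  impossible in finite length. So some \<open>e h\<close> lies outside (\<open>idempotent_part_not_covered\<close>), and
  \<open>z + e h\<close> generates more than \<open>z\<close>, against the choice of \<open>z\<close>. Hence the annihilator is \<open>J\<close>, the
  endomorphism is injective modulo \<open>J\<close>, thus surjective, and \<open>A z + J H = H\<close>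
  (\<open>generates_if_annihilator_radical\<close>). Finally \<open>z\<close> itself is invertible, by Nakayama-type arguments: a
  generator modulo \<open>J H\<close> has a left inverse, and the defect of that inverse on the other side is an
  idempotent in \<open>J\<close>, so it vanishes (\<open>invertible_intertwiner\<close>).
\<close>

section \<open>The Jacobson radical of a unital subring\<close>

locale unital_subring =
  fixes A :: "'a::ring_1 set"
  assumes one_mem: "1 \<in> A"
    and diff_mem: "x \<in> A \<Longrightarrow> y \<in> A \<Longrightarrow> x - y \<in> A"
    and mult_mem: "x \<in> A \<Longrightarrow> y \<in> A \<Longrightarrow> x * y \<in> A"
begin

abbreviation R :: "'a ring" where
  "R \<equiv> \<lparr>carrier = A, mult = (*), one = 1, zero = 0, add = (+)\<rparr>"

abbreviation J :: "'a set" where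
  "J \<equiv> jacobson_radical R"

lemma zero_mem: "0 \<in> A"
  using diff_mem[OF one_mem one_mem] by simp

lemma uminus_mem: "x \<in> A \<Longrightarrow> - x \<in> A"
  using diff_mem[OF zero_mem] by simp

lemma add_mem: "x \<in> A \<Longrightarrow> y \<in> A \<Longrightarrow> x + y \<in> A"
  using diff_mem[of x "- y"] uminus_mem by simp

lemmas mem = zero_mem one_mem uminus_mem add_mem diff_mem mult_mem

lemma ring_R: "ring R"
proof (rule ringI)
  show "abelian_group R"
    by (rule abelian_groupI)
      (auto simp: add_mem zero_mem add.assoc add.commute intro!: bexI[of _ "- x" for x] uminus_mem)
  show "monoid R"
    by (rule monoidI) (auto simp: one_mem mult_mem mult.assoc)
qed (auto simp: distrib_left distrib_right)

lemma a_inv_R: "x \<in> A \<Longrightarrow> \<ominus>\<^bsub>R\<^esub> x = - x"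
  using abelian_group.minus_equality[OF ring.is_abelian_group[OF ring_R], of "- x" x]
  by (simp add: uminus_mem)

lemma left_ideal_iff:
  "left_ideal L R \<longleftrightarrow>
     L \<subseteq> A \<and> 0 \<in> L \<and> (\<forall>x\<in>L. \<forall>y\<in>L. x + y \<in> L) \<and> (\<forall>r\<in>A. \<forall>x\<in>L. r * x \<in> L)"
proof -
  have "subgroup L (add_monoid R)"
    if L: "L \<subseteq> A" "0 \<in> L" "\<forall>x\<in>L. \<forall>y\<in>L. x + y \<in> L" "\<forall>r\<in>A. \<forall>x\<in>L. r * x \<in> L"
  proof (rule group.subgroupI[OF abelian_group.a_group[OF ring.is_abelian_group[OF ring_R]]])
    show "inv\<^bsub>add_monoid R\<^esub> a \<in> L" if "a \<in> L" for a
    proof -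
      have "inv\<^bsub>add_monoid R\<^esub> a = - 1 * a"
        using a_inv_R[of a] that L(1) by (auto simp: a_inv_def)
      then show ?thesis
        using L(4) that uminus_mem[OF one_mem] by metis
    qed
  qed (use L in auto)
  then show ?thesis
    by (auto simp: left_ideal_def additive_subgroup_def subgroup_def)
qed

lemma left_idealI:
  assumes "L \<subseteq> A" "0 \<in> L" "\<And>x y. x \<in> L \<Longrightarrow> y \<in> L \<Longrightarrow> x + y \<in> L"
    and "\<And>r x. r \<in> A \<Longrightarrow> x \<in> L \<Longrightarrow> r * x \<in> L"
  shows "left_ideal L R"
  using assms by (simp add: left_ideal_iff)

lemma left_idealD:
  assumes "left_ideal L R"
  shows "x \<in> L \<Longrightarrow> x \<in> A" "0 \<in> L" "x \<in> L \<Longrightarrow> y \<in> L \<Longrightarrow> x + y \<in> L"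
    and "r \<in> A \<Longrightarrow> x \<in> L \<Longrightarrow> r * x \<in> L" "x \<in> L \<Longrightarrow> - x \<in> L" "x \<in> L \<Longrightarrow> y \<in> L \<Longrightarrow> x - y \<in> L"
proof -
  show *: "x \<in> L \<Longrightarrow> x \<in> A" "0 \<in> L" "x \<in> L \<Longrightarrow> y \<in> L \<Longrightarrow> x + y \<in> L" "r \<in> A \<Longrightarrow> x \<in> L \<Longrightarrow> r * x \<in> L"
    for x y r
    using assms by (auto simp: left_ideal_iff)
  show **: "x \<in> L \<Longrightarrow> - x \<in> L" for x
    using *(4)[of "- 1" x] uminus_mem[OF one_mem] by simp
  show "x \<in> L \<Longrightarrow> y \<in> L \<Longrightarrow> x - y \<in> L"
    using *(3)[of x "- y"] ** by simp
qed

text \<open>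
  Together with \<open>left_ideal_right_mult\<close>, this yields the left ideals \<open>A a + M\<close> and \<open>M a + J\<close> to which
  maximality and minimality are applied below.
\<close>

lemma left_ideal_sum:
  assumes "left_ideal L R" "left_ideal M R"
  shows "left_ideal {l + m |l m. l \<in> L \<and> m \<in> M} R"
proof (rule left_idealI)
  show "0 \<in> {l + m |l m. l \<in> L \<and> m \<in> M}"
    using left_idealD(2)[OF assms(1)] left_idealD(2)[OF assms(2)] by force
  fix x y assume "x \<in> {l + m |l m. l \<in> L \<and> m \<in> M}" "y \<in> {l + m |l m. l \<in> L \<and> m \<in> M}"
  then obtain l m l' m' where
    *: "x = l + m" "y = l' + m'" "l \<in> L" "m \<in> M" "l' \<in> L" "m' \<in> M" by blast
  have "x + y = (l + l') + (m + m')" using * by simp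
  then show "x + y \<in> {l + m |l m. l \<in> L \<and> m \<in> M}"
    using * left_idealD(3)[OF assms(1)] left_idealD(3)[OF assms(2)] by blast
next
  fix r x assume "r \<in> A" "x \<in> {l + m |l m. l \<in> L \<and> m \<in> M}"
  then obtain l m where "x = l + m" "l \<in> L" "m \<in> M" by blast
  then show "r * x \<in> {l + m |l m. l \<in> L \<and> m \<in> M}"
    using left_idealD(4)[OF assms(1) \<open>r \<in> A\<close>] left_idealD(4)[OF assms(2) \<open>r \<in> A\<close>] distrib_left by blast
qed (use left_idealD(1)[OF assms(1)] left_idealD(1)[OF assms(2)] add_mem in blast)

lemma left_ideal_right_mult:
  assumes "left_ideal L R" "a \<in> A"
  shows "left_ideal {l * a |l. l \<in> L} R"
proof (rule left_idealI)
  show "0 \<in> {l * a |l. l \<in> L}"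
    using left_idealD(2)[OF assms(1)] by (metis (mono_tags, lifting) mem_Collect_eq mult_zero_left)
  fix x y assume "x \<in> {l * a |l. l \<in> L}" "y \<in> {l * a |l. l \<in> L}"
  then show "x + y \<in> {l * a |l. l \<in> L}"
    using left_idealD(3)[OF assms(1)] by (auto simp flip: distrib_right)
next
  fix r x assume "r \<in> A" "x \<in> {l * a |l. l \<in> L}"
  then show "r * x \<in> {l * a |l. l \<in> L}"
    using left_idealD(4)[OF assms(1)] by (auto simp flip: mult.assoc)
qed (use left_idealD(1)[OF assms(1)] assms(2) mult_mem in blast)

lemma left_ideal_A: "left_ideal A R"
  by (rule left_idealI) (auto simp: mem)

lemma exists_maximal_left_ideal:
  assumes L: "left_ideal L R" and "1 \<notin> L"
  obtains M where "maximal_left_ideal M R" "L \<subseteq> M"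
proof -
  let ?F = "{M. left_ideal M R \<and> L \<subseteq> M \<and> 1 \<notin> M}"
  have "\<exists>M\<in>?F. \<forall>X\<in>?F. M \<subseteq> X \<longrightarrow> X = M"
  proof (rule subset_Zorn_nonempty)
    show "?F \<noteq> {}" using assms by auto
    fix C assume "C \<noteq> {}" and C: "subset.chain ?F C"
    then obtain M0 where M0: "M0 \<in> C" by auto
    have F: "left_ideal M R" "L \<subseteq> M" "1 \<notin> M" if "M \<in> C" for M
      using C that by (auto simp: subset.chain_def)
    have "left_ideal (\<Union>C) R"
    proof (rule left_idealI)
      show "\<Union>C \<subseteq> A" using F left_idealD(1) by blast
      show "0 \<in> \<Union>C" using M0 F left_idealD(2) by blast
      fix x y assume "x \<in> \<Union>C" "y \<in> \<Union>C"
      then obtain X Y where XY: "X \<in> C" "Y \<in> C" "x \<in> X" "y \<in> Y" by blast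
      then have "X \<subseteq> Y \<or> Y \<subseteq> X"
        using C by (auto simp: subset.chain_def)
      then show "x + y \<in> \<Union>C"
        using XY F(1) left_idealD(3) by (meson UnionI subsetD)
    next
      fix r x assume "r \<in> A" "x \<in> \<Union>C"
      then show "r * x \<in> \<Union>C" using F(1) left_idealD(4) by blast
    qed
    then show "\<Union>C \<in> ?F" using F M0 by blast
  qed
  then obtain M where "M \<in> ?F" and max: "\<forall>X\<in>?F. M \<subseteq> X \<longrightarrow> X = M"
    by (elim bexE)
  then have M: "left_ideal M R" "L \<subseteq> M" "1 \<notin> M" by simp_all
  have top: "X = A" if "left_ideal X R" "1 \<in> X" for X
  proof
    show "X \<subseteq> A" using left_idealD(1)[OF that(1)] by blast
    show "A \<subseteq> X" using left_idealD(4)[OF that(1) _ that(2)] by (metis mult_1_right subsetI)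
  qed
  then have "X = M \<or> X = A" if "left_ideal X R" "M \<subseteq> X" for X
  proof (cases "1 \<in> X")
    case False
    then have "X \<in> ?F" using that M(2) by simp
    then show ?thesis using max that(2) by simp
  qed (use top that(1) in simp)
  moreover have "M \<noteq> A" using M(3) one_mem by blast
  ultimately have "maximal_left_ideal M R"
    unfolding maximal_left_ideal_def using M(1) by simp
  then show ?thesis using M(2) that by blast
qed

lemma maximal_left_idealD:
  assumes "maximal_left_ideal M R"
  shows "left_ideal M R" "1 \<notin> M"
    and "a \<in> A \<Longrightarrow> a \<notin> M \<Longrightarrow> \<exists>b\<in>A. \<exists>m\<in>M. 1 = b * a + m"
proof -
  show M: "left_ideal M R"
    using assms by (simp add: maximal_left_ideal_def)
  show "1 \<notin> M"
  proof
    assume "1 \<in> M"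
    then have "A \<subseteq> M" using left_idealD(4)[OF M, of _ 1] by (metis mult_1_right subsetI)
    then have "M = A" using left_idealD(1)[OF M] by blast
    then show False using assms by (simp add: maximal_left_ideal_def)
  qed
  assume a: "a \<in> A" "a \<notin> M"
  let ?N = "{l + m |l m. l \<in> {b * a |b. b \<in> A} \<and> m \<in> M}"
  have N: "left_ideal ?N R"
    by (intro left_ideal_sum left_ideal_right_mult left_ideal_A a M)
  have "M \<subseteq> ?N"
  proof
    fix m assume "m \<in> M"
    moreover have "m = 0 * a + m" by simp
    ultimately show "m \<in> ?N" using zero_mem by blast
  qed
  moreover have "a \<in> ?N"
  proof -
    have "a = 1 * a + 0" by simp
    then show ?thesis using one_mem left_idealD(2)[OF M] by blast
  qed
  ultimately have "?N = A"
    using assms N a(2) unfolding maximal_left_ideal_def by fastforce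
  then have "1 \<in> ?N" using one_mem by simp
  then show "\<exists>b\<in>A. \<exists>m\<in>M. 1 = b * a + m" by blast
qed

lemma radical_iff: "x \<in> J \<longleftrightarrow> x \<in> A \<and> (\<forall>M. maximal_left_ideal M R \<longrightarrow> x \<in> M)"
  by (simp add: jacobson_radical_def)

lemma left_ideal_radical: "left_ideal J R"
  by (rule left_idealI)
    (auto simp: radical_iff mem intro: left_idealD[OF maximal_left_idealD(1)])

lemmas radical = left_idealD[OF left_ideal_radical]

text \<open>
  For a maximal left ideal \<open>M\<close> and \<open>b \<notin> M\<close>, the left ideal of all \<open>a\<close> with \<open>a b \<in> M\<close> is again maximal,
  because \<open>A / N \<cong> (A b + M) / M = A / M\<close> for this left ideal \<open>N\<close>.
\<close>

lemma radical_mult_right: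
  assumes x: "x \<in> J" and b: "b \<in> A"
  shows "x * b \<in> J"
  unfolding radical_iff
proof (intro conjI allI impI)
  show "x * b \<in> A" using radical(1)[OF x] b by (rule mult_mem)
  fix M assume max: "maximal_left_ideal M R"
  note M = left_idealD[OF maximal_left_idealD(1)[OF max]]
  let ?N = "{a \<in> A. a * b \<in> M}"
  have N: "left_ideal ?N R"
    by (rule left_idealI) (auto simp: mem M distrib_right mult.assoc)
  show "x * b \<in> M"
  proof (cases "b \<in> M")
    case True
    then show ?thesis using M(4) radical(1)[OF x] by blast
  next
    case False
    have "1 \<notin> ?N" using False by simp
    have "A = X" if X: "left_ideal X R" "?N \<subseteq> X" "X \<noteq> ?N" for X
    proof -
      note X' = left_idealD[OF X(1)]
      obtain c where c: "c \<in> X" "c * b \<notin> M" using X X'(1) by blast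
      have cb: "c * b \<in> A" using c X'(1) b by (simp add: mult_mem)
      obtain d m where d: "d \<in> A" "m \<in> M" "1 = d * (c * b) + m"
        using maximal_left_idealD(3)[OF max cb c(2)] by blast
      have "b = b * d * c * b + b * m"
        using arg_cong[OF d(3), of "\<lambda>z. b * z"] by (simp add: distrib_left mult.assoc)
      then have "(1 - b * d * c) * b = b * m"
        by (simp add: left_diff_distrib algebra_simps)
      moreover have "b * m \<in> M" using M(4)[OF b d(2)] .
      ultimately have "1 - b * d * c \<in> ?N"
        using b d c X'(1) by (auto simp: mem)
      then have "(1 - b * d * c) + (b * d) * c \<in> X"
        using X(2) X'(3,4) b d(1) c(1) mult_mem by blast
      then have "1 \<in> X" by (simp add: mult.assoc)
      then have "A \<subseteq> X" using X'(4)[of _ 1] by (metis mult_1_right subsetI)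
      then show ?thesis using X'(1) by blast
    qed
    moreover have "?N \<noteq> A" using \<open>1 \<notin> ?N\<close> one_mem by blast
    ultimately have "maximal_left_ideal ?N R"
      unfolding maximal_left_ideal_def using N by (metis (no_types, lifting) partial_object.select_convs(1))
    then show ?thesis using x unfolding radical_iff by blast
  qed
qed

lemma radical_left_inverse:
  assumes j: "j \<in> J"
  obtains u where "u \<in> A" "u * (1 - j) = 1"
proof -
  have a: "1 - j \<in> A" using radical(1)[OF j] by (simp add: mem)
  have "1 \<in> {b * (1 - j) |b. b \<in> A}"
  proof (rule ccontr)
    assume "1 \<notin> {b * (1 - j) |b. b \<in> A}"
    then obtain M where M: "maximal_left_ideal M R" "{b * (1 - j) |b. b \<in> A} \<subseteq> M"
      using exists_maximal_left_ideal[OF left_ideal_right_mult[OF left_ideal_A a]] by blast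
    have "1 * (1 - j) \<in> M" using M(2) one_mem by blast
    moreover have "j \<in> M" using j M(1) by (simp add: radical_iff)
    ultimately have "1 * (1 - j) + j \<in> M"
      using left_idealD(3)[OF maximal_left_idealD(1)[OF M(1)]] by blast
    then show False using maximal_left_idealD(2)[OF M(1)] by simp
  qed
  then show ?thesis using that by force
qed

text \<open>
  A left inverse \<open>u\<close> of \<open>1 - j\<close> is again of the form \<open>1 - j'\<close> with \<open>j' \<in> J\<close>, so it has a left
  inverse itself, and this must be \<open>1 - j\<close>.
\<close>

lemma radical_inverse:
  assumes j: "j \<in> J"
  obtains u where "u \<in> A" "u * (1 - j) = 1" "(1 - j) * u = 1"
proof -
  obtain u where u: "u \<in> A" "u * (1 - j) = 1" using radical_left_inverse[OF j] .
  have u1: "u = 1 - (- (u * j))" using u(2) by (simp add: right_diff_distrib algebra_simps)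
  have "- (u * j) \<in> J" using radical(4,5) u(1) j by blast
  then obtain w where w: "w \<in> A" "w * u = 1" using radical_left_inverse u1 by metis
  have "w = 1 - j"
    using u(2) w(2) by (metis mult.assoc mult_1_left mult_1_right)
  then show ?thesis using u w that by blast
qed

text \<open>
  If \<open>l \<in> L\<close> were outside a maximal left ideal \<open>M\<close>, then \<open>1 = b l + m\<close> with \<open>m \<in> M\<close>, and multiplying
  by \<open>l\<close> from the left puts \<open>l = l (b l) + l m\<close> into \<open>M\<close>.
\<close>

lemma square_subset_radical:
  assumes L: "left_ideal L R" and sq: "\<And>x y. x \<in> L \<Longrightarrow> y \<in> L \<Longrightarrow> x * y \<in> J"
  shows "L \<subseteq> J"
proof
  fix l assume l: "l \<in> L"
  show "l \<in> J"
    unfolding radical_iff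
  proof (intro conjI allI impI)
    show lA: "l \<in> A" using left_idealD(1)[OF L l] .
    fix M assume max: "maximal_left_ideal M R"
    note M = left_idealD[OF maximal_left_idealD(1)[OF max]]
    show "l \<in> M"
    proof (rule ccontr)
      assume "l \<notin> M"
      then obtain b m where b: "b \<in> A" "m \<in> M" "1 = b * l + m"
        using maximal_left_idealD(3)[OF max lA] by blast
      have "l = l * (b * l) + l * m"
        using arg_cong[OF b(3), of "\<lambda>z. l * z"] by (simp add: distrib_left)
      moreover have "l * (b * l) \<in> M"
        using sq[OF l left_idealD(4)[OF L b(1) l]] max by (simp add: radical_iff)
      moreover have "l * m \<in> M" using M(4) lA b(2) by blast
      ultimately show False using M(3) \<open>l \<notin> M\<close> by metis
    qed
  qed
qed

end

section \<open>Finite length modulo the radical\<close>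

text \<open>
  This says that \<open>A / J\<close> has finite length as a left module over itself, without forming the quotient:
  its submodules are the left ideals above \<open>J\<close>. All congruences below are modulo \<open>J\<close>.
\<close>

locale finite_length_mod_radical = unital_subring +
  fixes len :: "'a set \<Rightarrow> nat" and bound :: nat
  assumes len_le: "left_ideal L R \<Longrightarrow> J \<subseteq> L \<Longrightarrow> len L \<le> bound"
    and len_strict: "left_ideal L R \<Longrightarrow> left_ideal M R \<Longrightarrow> J \<subseteq> L \<Longrightarrow> L \<subset> M \<Longrightarrow> len L < len M"
begin

text \<open>
  Brauer's lemma, modulo \<open>J\<close>. A left ideal \<open>M\<close> that is minimal among those strictly above \<open>J\<close> is not
  nilpotent modulo \<open>J\<close>, so \<open>M a + J = M\<close> for some \<open>a \<in> M\<close>. In particular \<open>e a \<equiv> a\<close> for some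
  \<open>e \<in> M\<close>, and \<open>e e - e\<close> lies in the annihilator of \<open>a\<close> in \<open>M\<close>, which is \<open>J\<close> by minimality.
\<close>

lemma exists_idempotent_mod_radical:
  assumes L: "left_ideal L R" "J \<subseteq> L" "L \<noteq> J"
  obtains e where "e \<in> L" "e \<notin> J" "e * e - e \<in> J"
proof -
  let ?P = "\<lambda>M. left_ideal M R \<and> J \<subseteq> M \<and> M \<noteq> J \<and> M \<subseteq> L"
  have "\<exists>M. ?P M \<and> (\<forall>N. ?P N \<longrightarrow> len M \<le> len N)"
    by (rule ex_has_least_nat[of _ L]) (use L in simp)
  then obtain M where M0: "?P M \<and> (\<forall>N. ?P N \<longrightarrow> len M \<le> len N)" ..
  then have M: "left_ideal M R" "J \<subseteq> M" "M \<noteq> J" "M \<subseteq> L" by simp_all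
  have least: "\<forall>N. ?P N \<longrightarrow> len M \<le> len N" using M0 by (rule conjunct2)
  have min: "N = M" if "left_ideal N R" "J \<subseteq> N" "N \<noteq> J" "N \<subseteq> M" for N
  proof (rule ccontr)
    assume "N \<noteq> M"
    then have "len N < len M" using len_strict[of N M] that M(1) by blast
    moreover have "len M \<le> len N" using least that M(4) by simp
    ultimately show False by simp
  qed
  note M' = left_idealD[OF M(1)]
  obtain b a where a: "b \<in> M" "a \<in> M" "b * a \<notin> J"
    using square_subset_radical[OF M(1)] M(2,3) by blast
  have aA: "a \<in> A" using M'(1) a(2) .
  let ?N = "{l + m |l m. l \<in> {l * a |l. l \<in> M} \<and> m \<in> J}"
  have "?N = M"
  proof (rule min)
    show "left_ideal ?N R"
      by (intro left_ideal_sum left_ideal_right_mult left_ideal_radical M(1) aA)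
    show "J \<subseteq> ?N"
    proof
      fix j assume "j \<in> J"
      moreover have "j = 0 * a + j" by simp
      ultimately show "j \<in> ?N" using M'(2) by blast
    qed
    have "b * a = b * a + 0" by simp
    then have "b * a \<in> ?N" using a(1) radical(2) by blast
    then show "?N \<noteq> J" using a(3) by blast
    show "?N \<subseteq> M" using M'(1,3,4) a(2) M(2) by blast
  qed
  then have aN: "a \<in> ?N" using a(2) by (rule ssubst)
  have "\<exists>e\<in>M. \<exists>j\<in>J. e * a = x - j" if x: "x \<in> ?N" for x
  proof -
    obtain l j where lj: "x = l + j" "l \<in> {l * a |l. l \<in> M}" "j \<in> J"
      using x by blast
    obtain e where "l = e * a" "e \<in> M" using lj(2) by blast
    then show ?thesis using lj(1,3) by (intro bexI[of _ e] bexI[of _ j]) auto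
  qed
  from this[OF aN] obtain e j where e: "e * a = a - j" "e \<in> M" "j \<in> J"
    by (elim bexE) (rule that)
  have eA: "e \<in> A" using M'(1) e(2) .
  have ann: "{l \<in> M. l * a \<in> J} = J"
  proof (rule ccontr)
    assume 1: "{l \<in> M. l * a \<in> J} \<noteq> J"
    have 2: "left_ideal {l \<in> M. l * a \<in> J} R"
      by (rule left_idealI) (auto simp: M' radical distrib_right mult.assoc)
    have 3: "J \<subseteq> {l \<in> M. l * a \<in> J}"
      using M(2) radical_mult_right aA by blast
    have "{l \<in> M. l * a \<in> J} = M" by (rule min[OF 2 3 1]) blast
    then show False using a(1,3) by blast
  qed
  have ea: "(e * e - e) * a = - (e * j)"
  proof -
    have "e * (e * a) = e * a - e * j" unfolding e(1) by (simp add: right_diff_distrib e(1))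
    then show ?thesis by (simp add: left_diff_distrib mult.assoc)
  qed
  have "- (e * j) \<in> J" by (intro radical(4,5) eA e(3))
  then have "(e * e - e) * a \<in> J" unfolding ea .
  moreover have "e * e - e \<in> M" by (intro M'(4,6) eA e(2))
  ultimately have "e * e - e \<in> J" using ann by blast
  moreover have "e \<in> L" using M(4) e(2) by (rule subsetD)
  moreover have "e \<notin> J"
  proof
    assume "e \<in> J"
    then have "e * a + j \<in> J" by (intro radical(3) radical_mult_right aA e(3))
    then have "a \<in> J" by (simp add: e(1))
    then have "b * a \<in> J" by (intro radical(4) M'(1)[OF a(1)])
    then show False using a(3) by contradiction
  qed
  ultimately show ?thesis by (intro that)
qed

end

context finite_length_mod_radical
begin

text \<open>
  A submodule of \<open>(A / J)\<^sup>m\<close>, given by its preimage in \<open>A\<^sup>m\<close>. Rows are functions of which only the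
  entries below \<open>m\<close> matter; the last condition makes the set independent of the other entries and,
  at the same time, saturated modulo \<open>J\<close>.
\<close>

definition row_submodule :: "nat \<Rightarrow> (nat \<Rightarrow> 'a) set \<Rightarrow> bool" where
  "row_submodule m N \<longleftrightarrow>
     N \<noteq> {} \<and> (\<forall>v\<in>N. \<forall>i<m. v i \<in> A) \<and>
     (\<forall>v\<in>N. \<forall>w\<in>N. (\<lambda>i. v i + w i) \<in> N) \<and>
     (\<forall>r\<in>A. \<forall>v\<in>N. (\<lambda>i. r * v i) \<in> N) \<and>
     (\<forall>v\<in>N. \<forall>w. (\<forall>i<m. w i - v i \<in> J) \<longrightarrow> w \<in> N)"

lemma row_submoduleI:
  assumes "N \<noteq> {}" "\<And>v i. v \<in> N \<Longrightarrow> i < m \<Longrightarrow> v i \<in> A"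
    and "\<And>v w. v \<in> N \<Longrightarrow> w \<in> N \<Longrightarrow> (\<lambda>i. v i + w i) \<in> N"
    and "\<And>r v. r \<in> A \<Longrightarrow> v \<in> N \<Longrightarrow> (\<lambda>i. r * v i) \<in> N"
    and "\<And>v w. v \<in> N \<Longrightarrow> (\<And>i. i < m \<Longrightarrow> w i - v i \<in> J) \<Longrightarrow> w \<in> N"
  shows "row_submodule m N"
  unfolding row_submodule_def using assms by simp

lemma row_submoduleD:
  assumes "row_submodule m N"
  shows "N \<noteq> {}" "v \<in> N \<Longrightarrow> i < m \<Longrightarrow> v i \<in> A"
    and "v \<in> N \<Longrightarrow> w \<in> N \<Longrightarrow> (\<lambda>i. v i + w i) \<in> N"
    and "r \<in> A \<Longrightarrow> v \<in> N \<Longrightarrow> (\<lambda>i. r * v i) \<in> N"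
    and "v \<in> N \<Longrightarrow> (\<And>i. i < m \<Longrightarrow> w i - v i \<in> J) \<Longrightarrow> w \<in> N"
    and "(\<lambda>i. 0) \<in> N" "v \<in> N \<Longrightarrow> w \<in> N \<Longrightarrow> (\<lambda>i. v i - w i) \<in> N"
proof -
  show *: "N \<noteq> {}" "v \<in> N \<Longrightarrow> i < m \<Longrightarrow> v i \<in> A"
    "v \<in> N \<Longrightarrow> w \<in> N \<Longrightarrow> (\<lambda>i. v i + w i) \<in> N"
    "r \<in> A \<Longrightarrow> v \<in> N \<Longrightarrow> (\<lambda>i. r * v i) \<in> N"
    "v \<in> N \<Longrightarrow> (\<And>i. i < m \<Longrightarrow> w i - v i \<in> J) \<Longrightarrow> w \<in> N" for r v w i
    using assms unfolding row_submodule_def by blast+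
  obtain u where "u \<in> N" using *(1) by blast
  then show "(\<lambda>i. 0) \<in> N" using *(4)[OF zero_mem, of u] by simp
  assume "v \<in> N" "w \<in> N"
  then show "(\<lambda>i. v i - w i) \<in> N"
    using *(3)[OF \<open>v \<in> N\<close> *(4)[OF uminus_mem[OF one_mem] \<open>w \<in> N\<close>]] by simp
qed

lemma left_ideal_last_entry:
  assumes N: "row_submodule (Suc m) N"
  shows "left_ideal {v m |v. v \<in> N} R" "J \<subseteq> {v m |v. v \<in> N}"
proof -
  note N' = row_submoduleD[OF N]
  show "left_ideal {v m |v. v \<in> N} R"
  proof (rule left_idealI)
    show "{v m |v. v \<in> N} \<subseteq> A" using N'(2) by blast
    show "0 \<in> {v m |v. v \<in> N}" using N'(6) by force
  next
    fix x y assume "x \<in> {v m |v. v \<in> N}" "y \<in> {v m |v. v \<in> N}"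
    then show "x + y \<in> {v m |v. v \<in> N}" using N'(3) by force
  next
    fix r x assume "r \<in> A" "x \<in> {v m |v. v \<in> N}"
    then show "r * x \<in> {v m |v. v \<in> N}" using N'(4) by force
  qed
  show "J \<subseteq> {v m |v. v \<in> N}"
  proof
    fix j assume "j \<in> J"
    then have "(\<lambda>i. if i = m then j else 0) \<in> N"
      by (intro N'(5)[OF N'(6)]) (auto simp: radical(2))
    then show "j \<in> {v m |v. v \<in> N}"
      by (intro CollectI exI[of _ "\<lambda>i. if i = m then j else 0"]) simp
  qed
qed

lemma row_submodule_truncate:
  assumes N: "row_submodule (Suc m) N"
  shows "row_submodule m {v. v(m := 0) \<in> N}"
proof (rule row_submoduleI)
  note N' = row_submoduleD[OF N]
  have "(\<lambda>i. 0)(m := 0) = (\<lambda>i. 0 :: 'a)" by auto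
  then show "{v. v(m := 0) \<in> N} \<noteq> {}" using N'(6) by (metis empty_iff mem_Collect_eq)
  show "v i \<in> A" if "v \<in> {v. v(m := 0) \<in> N}" "i < m" for v i
    using N'(2)[of "v(m := 0)" i] that by simp
  show "(\<lambda>i. v i + w i) \<in> {v. v(m := 0) \<in> N}"
    if "v \<in> {v. v(m := 0) \<in> N}" "w \<in> {v. v(m := 0) \<in> N}" for v w
  proof -
    have "(\<lambda>i. v i + w i)(m := 0) = (\<lambda>i. (v(m := 0)) i + (w(m := 0)) i)" by auto
    also have "\<dots> \<in> N" using N'(3) that by blast
    finally show ?thesis by simp
  qed
  show "(\<lambda>i. r * v i) \<in> {v. v(m := 0) \<in> N}"
    if "r \<in> A" "v \<in> {v. v(m := 0) \<in> N}" for r v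
  proof -
    have "(\<lambda>i. r * v i)(m := 0) = (\<lambda>i. r * (v(m := 0)) i)" by auto
    also have "\<dots> \<in> N" using N'(4) that by blast
    finally show ?thesis by simp
  qed
  show "w \<in> {v. v(m := 0) \<in> N}"
    if "v \<in> {v. v(m := 0) \<in> N}" "\<And>i. i < m \<Longrightarrow> w i - v i \<in> J" for v w
  proof -
    have "(w(m := 0)) i - (v(m := 0)) i \<in> J" if less: "i < Suc m" for i
      using less \<open>\<And>i. i < m \<Longrightarrow> w i - v i \<in> J\<close>[of i] radical(2) by (cases "i = m") simp_all
    then show ?thesis using N'(5)[of "v(m := 0)" "w(m := 0)"] that(1) by blast
  qed
qed

text \<open>
  Exactness of \<open>A\<^sup>m \<rightarrow> A\<^bsup>m + 1\<^esup> \<rightarrow> A\<close>: a submodule is determined, among comparable ones, by its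
  projection to the last entry and its intersection with the kernel of that projection.
\<close>

lemma row_submodule_eqI:
  assumes N: "row_submodule (Suc m) N" and N': "row_submodule (Suc m) N'" and "N \<subseteq> N'"
    and last: "{v m |v. v \<in> N'} \<subseteq> {v m |v. v \<in> N}"
    and trunc: "{v. v(m := 0) \<in> N'} \<subseteq> {v. v(m := 0) \<in> N}"
  shows "N = N'"
proof
  show "N' \<subseteq> N"
  proof
    fix v assume v: "v \<in> N'"
    then obtain w where w: "w \<in> N" "w m = v m" using last by force
    have *: "(\<lambda>i. v i - w i)(m := 0) = (\<lambda>i. v i - w i)" using w(2) by auto
    have "(\<lambda>i. v i - w i) \<in> N'" using row_submoduleD(7)[OF N'] v w(1) \<open>N \<subseteq> N'\<close> by blast
    then have "(\<lambda>i. v i - w i) \<in> N"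
      using trunc * by (metis (no_types, lifting) mem_Collect_eq subset_eq)
    then show "v \<in> N" using row_submoduleD(3)[OF N _ w(1)] by fastforce
  qed
qed fact

text \<open>
  Length is additive along \<open>A\<^sup>m \<rightarrow> A\<^bsup>m + 1\<^esup> \<rightarrow> A\<close>, which gives the recursion on \<open>m\<close>.
\<close>

lemma row_length:
  "\<exists>l c. (\<forall>N. row_submodule m N \<longrightarrow> l N \<le> (c::nat)) \<and>
     (\<forall>N N'. row_submodule m N \<longrightarrow> row_submodule m N' \<longrightarrow> N \<subset> N' \<longrightarrow> l N < l N')"
proof (induction m)
  case 0
  have "N = UNIV" if "row_submodule 0 N" for N
    using row_submoduleD(1,5)[OF that] by blast
  then show ?case by (intro exI[of _ "\<lambda>_. 0"] exI[of _ 0]) (metis less_irrefl order.refl psubset_eq)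
next
  case (Suc m)
  then obtain l c where lc: "(\<forall>N. row_submodule m N \<longrightarrow> l N \<le> (c::nat)) \<and>
      (\<forall>N N'. row_submodule m N \<longrightarrow> row_submodule m N' \<longrightarrow> N \<subset> N' \<longrightarrow> l N < l N')"
    by (elim exE)
  note l = lc[THEN conjunct1, rule_format] lc[THEN conjunct2, rule_format]
  let ?l = "\<lambda>N. l {v. v(m := 0) \<in> N} + len {v m |v. v \<in> N}"
  have "?l N \<le> c + bound" if "row_submodule (Suc m) N" for N
    by (intro add_mono l(1) len_le row_submodule_truncate left_ideal_last_entry that)
  moreover have "?l N < ?l N'"
    if N: "row_submodule (Suc m) N" "row_submodule (Suc m) N'" "N \<subset> N'" for N N'
  proof -
    let ?t = "\<lambda>N. {v. v(m := 0) \<in> N}" and ?p = "\<lambda>N. {v m |v. v \<in> N}"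
    have t: "?t N \<subseteq> ?t N'" and p: "?p N \<subseteq> ?p N'" using N(3) by blast+
    have "\<not> (?t N' \<subseteq> ?t N \<and> ?p N' \<subseteq> ?p N)"
      using row_submodule_eqI[OF N(1,2)] N(3) by blast
    then consider "?t N \<subset> ?t N'" | "?t N = ?t N'" "?p N \<subset> ?p N'"
      using t p by blast
    then show ?thesis
    proof cases
      case 1
      have "l (?t N) < l (?t N')" by (intro l(2) row_submodule_truncate N 1)
      moreover have "len (?p N) \<le> len (?p N')"
        using len_strict[OF left_ideal_last_entry(1)[OF N(1)] left_ideal_last_entry(1)[OF N(2)]
            left_ideal_last_entry(2)[OF N(1)]] p
        by (cases "?p N = ?p N'") (auto simp: psubset_eq intro: less_imp_le)
      ultimately show ?thesis by simp
    next
      case 2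
      have "len (?p N) < len (?p N')"
        by (intro len_strict left_ideal_last_entry N 2)
      then show ?thesis using 2(1) by simp
    qed
  qed
  ultimately show ?case by (intro exI[of _ ?l] exI[of _ "c + bound"]) simp
qed

lemma ascending_rows_stabilise:
  fixes N :: "nat \<Rightarrow> (nat \<Rightarrow> 'a) set"
  assumes "\<And>t. row_submodule m (N t)" "\<And>t. N t \<subseteq> N (Suc t)"
  obtains t where "N (Suc t) = N t"
proof -
  obtain l c where lc: "(\<forall>N. row_submodule m N \<longrightarrow> l N \<le> (c::nat)) \<and>
      (\<forall>N N'. row_submodule m N \<longrightarrow> row_submodule m N' \<longrightarrow> N \<subset> N' \<longrightarrow> l N < l N')"
    using row_length[of m] by (elim exE)
  note l = lc[THEN conjunct1, rule_format] lc[THEN conjunct2, rule_format]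
  have "\<exists>t. N (Suc t) = N t"
  proof (rule ccontr)
    assume "\<not> ?thesis"
    then have *: "l (N t) < l (N (Suc t))" for t using assms l(2) by blast
    have "t \<le> l (N t)" for t
      by (induction t) (use * in \<open>auto intro: Suc_leI le_less_trans\<close>)
    then show False using l(1)[OF assms(1)] by (meson Suc_n_not_le_n order_trans)
  qed
  then show ?thesis using that by blast
qed

lemma descending_rows_stabilise:
  fixes N :: "nat \<Rightarrow> (nat \<Rightarrow> 'a) set"
  assumes "\<And>t. row_submodule m (N t)" "\<And>t. N (Suc t) \<subseteq> N t"
  obtains t where "N (Suc t) = N t"
proof -
  obtain l c where lc: "(\<forall>N. row_submodule m N \<longrightarrow> l N \<le> (c::nat)) \<and>
      (\<forall>N N'. row_submodule m N \<longrightarrow> row_submodule m N' \<longrightarrow> N \<subset> N' \<longrightarrow> l N < l N')"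
    using row_length[of m] by (elim exE)
  note l = lc[THEN conjunct2, rule_format]
  have "\<exists>t. N (Suc t) = N t"
  proof (rule ccontr)
    assume "\<not> ?thesis"
    then have *: "l (N (Suc t)) < l (N t)" for t using assms l by blast
    have "l (N t) + t \<le> l (N 0)" for t
    proof (induction t)
      case (Suc t)
      then show ?case using *[of t] by simp
    qed simp
    then show False by (meson Suc_n_not_le_n add_leE)
  qed
  then show ?thesis using that by blast
qed

end

section \<open>Endomorphisms of row modules\<close>

text \<open>
  The map \<open>\<phi>\<close> induces an endomorphism of \<open>(A / J)\<^sup>n\<close>, as it is linear and preserves \<open>J\<^sup>n\<close>. Additivity
  and linearity are demanded for all rows: the maps of interest are right multiplications by matrices.
\<close>

locale row_endomorphism = finite_length_mod_radical +
  fixes n :: nat and \<phi> :: "(nat \<Rightarrow> 'a) \<Rightarrow> nat \<Rightarrow> 'a"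
  assumes map_add: "\<phi> (\<lambda>i. v i + w i) = (\<lambda>i. \<phi> v i + \<phi> w i)"
    and map_smult: "\<phi> (\<lambda>i. r * v i) = (\<lambda>i. r * \<phi> v i)"
    and map_mem: "(\<And>i. i < n \<Longrightarrow> v i \<in> A) \<Longrightarrow> i < n \<Longrightarrow> \<phi> v i \<in> A"
    and map_radical: "(\<And>i. i < n \<Longrightarrow> v i \<in> J) \<Longrightarrow> i < n \<Longrightarrow> \<phi> v i \<in> J"
begin

lemma map_diff: "\<phi> (\<lambda>i. v i - w i) = (\<lambda>i. \<phi> v i - \<phi> w i)"
  using map_add[of v "\<lambda>i. - 1 * w i"] map_smult[of "- 1" w] by simp

lemma row_endomorphism_iterate: "row_endomorphism A len bound n (\<phi> ^^ t)"
proof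
  show "(\<phi> ^^ t) (\<lambda>i. v i + w i) = (\<lambda>i. (\<phi> ^^ t) v i + (\<phi> ^^ t) w i)" for v w
    by (induction t) (simp_all add: map_add)
  show "(\<phi> ^^ t) (\<lambda>i. r * v i) = (\<lambda>i. r * (\<phi> ^^ t) v i)" for r v
    by (induction t) (simp_all add: map_smult)
  show "(\<phi> ^^ t) v i \<in> A" if "\<And>i. i < n \<Longrightarrow> v i \<in> A" "i < n" for v i
    using that(2) by (induction t arbitrary: i) (simp_all add: map_mem that(1))
  show "(\<phi> ^^ t) v i \<in> J" if "\<And>i. i < n \<Longrightarrow> v i \<in> J" "i < n" for v i
    using that(2) by (induction t arbitrary: i) (simp_all add: map_radical that(1))
qed

lemma row_submodule_kernel:
  "row_submodule n {v. (\<forall>i<n. v i \<in> A) \<and> (\<forall>i<n. \<phi> v i \<in> J)}" (is "row_submodule n ?N")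
proof (rule row_submoduleI)
  have "\<forall>i<n. \<phi> (\<lambda>i. 0) i \<in> J" by (intro allI impI map_radical radical(2))
  then have "(\<lambda>i. 0) \<in> ?N" using zero_mem by blast
  then show "?N \<noteq> {}" by (metis empty_iff)
next
  show "v i \<in> A" if "v \<in> ?N" "i < n" for v i
    using that by simp
next
  fix v w assume "v \<in> ?N" "w \<in> ?N"
  then show "(\<lambda>i. v i + w i) \<in> ?N"
    unfolding map_add mem_Collect_eq by (simp add: add_mem radical(3))
next
  fix r v assume "r \<in> A" "v \<in> ?N"
  then show "(\<lambda>i. r * v i) \<in> ?N"
    unfolding map_smult mem_Collect_eq by (simp add: mult_mem radical(4))
next
  fix v w
  assume "v \<in> ?N" and w: "\<And>i. i < n \<Longrightarrow> w i - v i \<in> J"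
  then have v: "\<forall>i<n. v i \<in> A" "\<forall>i<n. \<phi> v i \<in> J" by simp_all
  have "\<phi> w i \<in> J" if "i < n" for i
  proof -
    have "\<phi> (\<lambda>i. w i - v i) i \<in> J" using w that by (rule map_radical)
    moreover have "\<phi> v i \<in> J" using v(2) that by simp
    ultimately have "\<phi> (\<lambda>i. w i - v i) i + \<phi> v i \<in> J" by (rule radical(3))
    then show ?thesis by (simp add: map_diff)
  qed
  moreover have "w i \<in> A" if "i < n" for i
    using add_mem[OF radical(1)[OF w[OF that]], of "v i"] v(1) that by simp
  ultimately show "w \<in> ?N" by simp
qed

lemma row_submodule_image:
  "row_submodule n {w. \<exists>v. (\<forall>i<n. v i \<in> A) \<and> (\<forall>i<n. w i - \<phi> v i \<in> J)}" (is "row_submodule n ?N")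
proof (rule row_submoduleI)
  have N: "w \<in> ?N" if "\<And>i. i < n \<Longrightarrow> v i \<in> A" "\<And>i. i < n \<Longrightarrow> w i - \<phi> v i \<in> J" for v w
    using that by blast
  have "\<phi> (\<lambda>i. 0) \<in> ?N"
    by (rule N[of "\<lambda>i. 0"]) (simp_all add: zero_mem radical(2))
  then show "?N \<noteq> {}" by blast
  show "v i \<in> A" if V: "v \<in> ?N" "i < n" for v i
  proof -
    obtain u where u: "\<forall>i<n. u i \<in> A" "\<forall>i<n. v i - \<phi> u i \<in> J" using V(1) by blast
    have "\<phi> u i \<in> A" using u(1) V(2) by (intro map_mem) simp_all
    moreover have "v i - \<phi> u i \<in> A" using u(2) V(2) radical(1) by simp
    ultimately have "(v i - \<phi> u i) + \<phi> u i \<in> A" by (intro add_mem)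
    then show ?thesis by simp
  qed
  show "(\<lambda>i. v i + w i) \<in> ?N" if V: "v \<in> ?N" "w \<in> ?N" for v w
  proof -
    obtain a where a: "\<forall>i<n. a i \<in> A" "\<forall>i<n. v i - \<phi> a i \<in> J" using V(1) by blast
    obtain b where b: "\<forall>i<n. b i \<in> A" "\<forall>i<n. w i - \<phi> b i \<in> J" using V(2) by blast
    show ?thesis
    proof (rule N)
      show "a i + b i \<in> A" if "i < n" for i using a(1) b(1) that by (simp add: add_mem)
      have "(v i - \<phi> a i) + (w i - \<phi> b i) \<in> J" if "i < n" for i
        using a(2) b(2) that by (intro radical(3)) simp_all
      then show "v i + w i - \<phi> (\<lambda>i. a i + b i) i \<in> J" if "i < n" for i
        unfolding map_add using that by (simp add: algebra_simps)
    qed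
  qed
  show "(\<lambda>i. r * v i) \<in> ?N" if V: "r \<in> A" "v \<in> ?N" for r v
  proof -
    obtain a where a: "\<forall>i<n. a i \<in> A" "\<forall>i<n. v i - \<phi> a i \<in> J" using V(2) by blast
    show ?thesis
    proof (rule N)
      show "r * a i \<in> A" if "i < n" for i using a(1) \<open>r \<in> A\<close> that by (simp add: mult_mem)
      have "r * (v i - \<phi> a i) \<in> J" if "i < n" for i
        using a(2) \<open>r \<in> A\<close> that by (intro radical(4)) simp_all
      then show "r * v i - \<phi> (\<lambda>i. r * a i) i \<in> J" if "i < n" for i
        unfolding map_smult using that by (simp add: right_diff_distrib)
    qed
  qed
  show "w \<in> ?N" if V: "v \<in> ?N" "\<And>i. i < n \<Longrightarrow> w i - v i \<in> J" for v w
  proof -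
    obtain a where a: "\<forall>i<n. a i \<in> A" "\<forall>i<n. v i - \<phi> a i \<in> J" using V(1) by blast
    show ?thesis
    proof (rule N)
      show "a i \<in> A" if "i < n" for i using a(1) that by simp
      have "(w i - v i) + (v i - \<phi> a i) \<in> J" if "i < n" for i
        using a(2) that \<open>\<And>i. i < n \<Longrightarrow> w i - v i \<in> J\<close> by (intro radical(3)) simp_all
      then show "w i - \<phi> a i \<in> J" if "i < n" for i using that by simp
    qed
  qed
qed

text \<open>
  On a module of finite length surjective endomorphisms are injective; here the
  surjectivity is only onto a set \<open>E\<close>, from that set. Pulling \<open>v\<close> back \<open>t\<close> times
  inside \<open>E\<close> gives \<open>u\<close> with \<open>\<phi>\<^sup>t u \<equiv> v\<close>, so \<open>u\<close> is in the kernel of \<open>\<phi>\<^bsup>t + 1\<^esup>\<close>. Once the kernels of the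
  iterates are stationary it is in the kernel of \<open>\<phi>\<^sup>t\<close>, so \<open>v \<equiv> 0\<close>.
\<close>

lemma kernel_trivial_on_surjective_part:
  assumes E: "\<And>v. v \<in> E \<Longrightarrow> \<forall>i<n. v i \<in> A"
    and surj: "\<And>v. v \<in> E \<Longrightarrow> \<exists>u\<in>E. \<forall>i<n. \<phi> u i - v i \<in> J"
    and v: "v \<in> E" "\<forall>i<n. \<phi> v i \<in> J"
  shows "\<forall>i<n. v i \<in> J"
proof -
  let ?N = "\<lambda>t. {v. (\<forall>i<n. v i \<in> A) \<and> (\<forall>i<n. (\<phi> ^^ t) v i \<in> J)}"
  obtain t where t: "?N (Suc t) = ?N t"
  proof (rule ascending_rows_stabilise)
    show "row_submodule n (?N t)" for t
      by (rule row_endomorphism.row_submodule_kernel[OF row_endomorphism_iterate])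
    show "?N t \<subseteq> ?N (Suc t)" for t
      using map_radical by auto
  qed
  have "\<exists>u\<in>E. \<forall>i<n. (\<phi> ^^ t) u i - v i \<in> J" for t
  proof (induction t)
    case 0
    then show ?case using v(1) radical(2) by (auto intro!: bexI[of _ v])
  next
    case (Suc t)
    then obtain u where u: "u \<in> E" "\<forall>i<n. (\<phi> ^^ t) u i - v i \<in> J" by blast
    obtain u' where u': "u' \<in> E" "\<forall>i<n. \<phi> u' i - u i \<in> J" using surj[OF u(1)] by blast
    interpret it: row_endomorphism A len bound n "\<phi> ^^ t" by (rule row_endomorphism_iterate)
    have "(\<phi> ^^ Suc t) u' i - v i \<in> J" if "i < n" for i
    proof -
      have "(\<phi> ^^ t) (\<lambda>i. \<phi> u' i - u i) i \<in> J"
        using it.map_radical[of "\<lambda>i. \<phi> u' i - u i" i] u'(2) that by simp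
      moreover have "(\<phi> ^^ t) u i - v i \<in> J" using u(2) that by simp
      ultimately have "(\<phi> ^^ t) (\<lambda>i. \<phi> u' i - u i) i + ((\<phi> ^^ t) u i - v i) \<in> J"
        by (rule radical(3))
      then show ?thesis by (simp add: it.map_diff funpow_swap1)
    qed
    then show ?case using u'(1) by blast
  qed
  then obtain u where u: "u \<in> E" "\<forall>i<n. (\<phi> ^^ t) u i - v i \<in> J" by blast
  have "(\<phi> ^^ Suc t) u i \<in> J" if "i < n" for i
  proof -
    have "\<phi> (\<lambda>i. (\<phi> ^^ t) u i - v i) i + \<phi> v i \<in> J"
      using map_radical[of "\<lambda>i. (\<phi> ^^ t) u i - v i" i] u(2) v(2) that by (intro radical(3)) simp_all
    then show ?thesis by (simp add: map_diff)
  qed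
  then have "u \<in> ?N (Suc t)" using E[OF u(1)] by blast
  then have u0: "\<forall>i<n. (\<phi> ^^ t) u i \<in> J" unfolding t by simp
  show ?thesis
  proof (intro allI impI)
    fix i assume "i < n"
    then have "(\<phi> ^^ t) u i - ((\<phi> ^^ t) u i - v i) \<in> J"
      by (intro radical(6)[OF u0[rule_format] u(2)[rule_format]])
    then show "v i \<in> J" by simp
  qed
qed

text \<open>
  Once the images of the iterates are stationary, \<open>\<phi>\<^sup>t v \<equiv> \<phi>\<^bsup>t + 1\<^esup> w\<close>, and \<open>\<phi>\<^sup>t\<close> can be cancelled.
\<close>

lemma injective_imp_surjective:
  assumes inj: "\<And>v. \<forall>i<n. v i \<in> A \<Longrightarrow> \<forall>i<n. \<phi> v i \<in> J \<Longrightarrow> \<forall>i<n. v i \<in> J"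
    and v: "\<forall>i<n. v i \<in> A"
  obtains w where "\<forall>i<n. w i \<in> A" "\<forall>i<n. v i - \<phi> w i \<in> J"
proof -
  let ?N = "\<lambda>t. {w. \<exists>v. (\<forall>i<n. v i \<in> A) \<and> (\<forall>i<n. w i - (\<phi> ^^ t) v i \<in> J)}"
  obtain t where t: "?N (Suc t) = ?N t"
  proof (rule descending_rows_stabilise)
    show "row_submodule n (?N t)" for t
      by (rule row_endomorphism.row_submodule_image[OF row_endomorphism_iterate])
    show "?N (Suc t) \<subseteq> ?N t" for t
    proof
      fix w assume "w \<in> ?N (Suc t)"
      then obtain v where "\<forall>i<n. v i \<in> A" "\<forall>i<n. w i - (\<phi> ^^ t) (\<phi> v) i \<in> J"
        by (auto simp: funpow_swap1)
      then show "w \<in> ?N t" using map_mem[of v] by (auto intro!: exI[of _ "\<phi> v"])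
    qed
  qed
  interpret it: row_endomorphism A len bound n "\<phi> ^^ t" by (rule row_endomorphism_iterate)
  have "(\<phi> ^^ t) v \<in> ?N t" using v radical(2) by auto
  then have "(\<phi> ^^ t) v \<in> ?N (Suc t)" using t by simp
  then obtain w where w: "\<forall>i<n. w i \<in> A" "\<forall>i<n. (\<phi> ^^ t) v i - (\<phi> ^^ t) (\<phi> w) i \<in> J"
    by (auto simp: funpow_swap1)
  have inj': "\<forall>i<n. u i \<in> J" if "\<forall>i<n. u i \<in> A" "\<forall>i<n. (\<phi> ^^ s) u i \<in> J" for u s
    using that
  proof (induction s arbitrary: u)
    case (Suc s)
    then have "\<forall>i<n. \<phi> u i \<in> J" using map_mem[of u] by (simp add: funpow_swap1)
    then show ?case using inj Suc.prems(1) by blast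
  qed simp
  have "\<forall>i<n. v i - \<phi> w i \<in> J"
  proof (rule inj')
    show "\<forall>i<n. v i - \<phi> w i \<in> A" using v w(1) map_mem[of w] by (simp add: diff_mem)
    show "\<forall>i<n. (\<phi> ^^ t) (\<lambda>i. v i - \<phi> w i) i \<in> J" using w(2) by (simp add: it.map_diff)
  qed
  then show ?thesis using that w(1) by blast
qed

end

section \<open>Intertwiners of elements with similar amplifications\<close>

definition intertwiners :: "'a::ring_1 \<Rightarrow> 'a \<Rightarrow> 'a set" where
  "intertwiners S T = {x. S * x = x * T}"

lemma intertwiners_mult:
  assumes "a \<in> intertwiners S T" "b \<in> intertwiners T U"
  shows "a * b \<in> intertwiners S U"
proof -
  have "S * (a * b) = (S * a) * b" by (simp only: mult.assoc)
  also have "\<dots> = a * (T * b)" using assms(1) by (simp add: intertwiners_def mult.assoc)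
  also have "\<dots> = (a * b) * U" using assms(2) by (simp add: intertwiners_def mult.assoc)
  finally show ?thesis by (simp add: intertwiners_def)
qed

lemma intertwiners_add: "a \<in> intertwiners S T \<Longrightarrow> b \<in> intertwiners S T \<Longrightarrow> a + b \<in> intertwiners S T"
  unfolding intertwiners_def by (simp add: distrib_left distrib_right)

lemma intertwiners_diff: "a \<in> intertwiners S T \<Longrightarrow> b \<in> intertwiners S T \<Longrightarrow> a - b \<in> intertwiners S T"
  unfolding intertwiners_def by (simp add: left_diff_distrib right_diff_distrib)

lemma intertwiners_zero: "0 \<in> intertwiners S T"
  unfolding intertwiners_def by simp

lemma intertwiners_one: "1 \<in> intertwiners S S"
  unfolding intertwiners_def by simp

lemma intertwiners_sum:
  "(\<And>i. i \<in> I \<Longrightarrow> f i \<in> intertwiners S T) \<Longrightarrow> sum f I \<in> intertwiners S T"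
  by (induction I rule: infinite_finite_induct) (auto simp: intertwiners_zero intro: intertwiners_add)

lemma unital_subring_intertwiners: "unital_subring (intertwiners S S)"
  by unfold_locales (fact intertwiners_one intertwiners_diff intertwiners_mult)+

text \<open>
  These elements form the Jacobson radical of the commutant of \<open>T\<close>, described through inverses rather
  than maximal left ideals. In this form closure under addition is a computation, and membership can be
  carried over from the commutant of another element by exchanging factors in \<open>1 - a b\<close>.
\<close>

definition quasi_regular :: "'a::ring_1 \<Rightarrow> 'a set" where
  "quasi_regular T = {q \<in> intertwiners T T.
     \<forall>b\<in>intertwiners T T. \<exists>u\<in>intertwiners T T. u * (1 - b * q) = 1 \<and> (1 - b * q) * u = 1}"

lemma quasi_regularD:
  assumes "q \<in> quasi_regular T"
  shows "q \<in> intertwiners T T"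
    and "b \<in> intertwiners T T \<Longrightarrow>
      \<exists>u\<in>intertwiners T T. u * (1 - b * q) = 1 \<and> (1 - b * q) * u = 1"
  using assms unfolding quasi_regular_def mem_Collect_eq
  by (rule conjunct1, rule conjunct2[THEN bspec])

text \<open>
  With \<open>u\<close> the inverse of \<open>1 - b q\<close>, the factorisation \<open>1 - b (q + r) = (1 - b q) (1 - u b r)\<close> has two
  invertible factors.
\<close>

lemma quasi_regular_add:
  assumes q: "q \<in> quasi_regular T" and r: "r \<in> quasi_regular T"
  shows "q + r \<in> quasi_regular T"
  unfolding quasi_regular_def mem_Collect_eq
proof (intro conjI ballI)
  show "q + r \<in> intertwiners T T"
    by (intro intertwiners_add quasi_regularD(1) q r)
  fix b assume b: "b \<in> intertwiners T T"
  obtain u where u: "u \<in> intertwiners T T" "u * (1 - b * q) = 1" "(1 - b * q) * u = 1"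
    using quasi_regularD(2)[OF q b] by (elim bexE conjE)
  obtain w where w: "w \<in> intertwiners T T" "w * (1 - u * b * r) = 1" "(1 - u * b * r) * w = 1"
    using quasi_regularD(2)[OF r intertwiners_mult[OF u(1) b]] by (elim bexE conjE)
  let ?p = "1 - b * q" and ?s = "1 - u * b * r"
  have "?p * ?s = ?p - ?p * u * (b * r)"
    by (simp only: right_diff_distrib mult_1_right mult.assoc)
  also have "\<dots> = 1 - b * (q + r)"
    unfolding u(3) by (simp add: distrib_left)
  finally have f: "1 - b * (q + r) = ?p * ?s" ..
  show "\<exists>v\<in>intertwiners T T. v * (1 - b * (q + r)) = 1 \<and> (1 - b * (q + r)) * v = 1"
  proof (intro bexI conjI)
    have "w * u * (?p * ?s) = w * ((u * ?p) * ?s)" by (simp only: mult.assoc)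
    then show "w * u * (1 - b * (q + r)) = 1" unfolding f u(2) by (simp only: mult_1_left w(2))
    have "?p * ?s * (w * u) = ?p * ((?s * w) * u)" by (simp only: mult.assoc)
    then show "(1 - b * (q + r)) * (w * u) = 1" unfolding f w(3) by (simp only: mult_1_left u(3))
    show "w * u \<in> intertwiners T T" using w(1) u(1) by (rule intertwiners_mult)
  qed
qed

lemma quasi_regular_zero: "0 \<in> quasi_regular T"
  unfolding quasi_regular_def mem_Collect_eq
  by (intro conjI ballI bexI[of _ 1] intertwiners_zero intertwiners_one) simp_all

lemma quasi_regular_sum:
  "(\<And>i. i \<in> I \<Longrightarrow> f i \<in> quasi_regular T) \<Longrightarrow> sum f I \<in> quasi_regular T"
  by (induction I rule: infinite_finite_induct) (auto simp: quasi_regular_zero intro: quasi_regular_add)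

text \<open>
  The matrices \<open>x\<close> and \<open>y\<close> are inverse to each other and intertwine the amplifications of \<open>S\<close> and
  \<open>T\<close>. They give mutually inverse isomorphisms between \<open>A\<^sup>n\<close> and \<open>H\<^sup>n\<close> by right multiplication.
\<close>

locale amplified_similarity =
  finite_length_mod_radical "intertwiners S S" len bound for S :: "'a::ring_1" and len bound +
  fixes T :: 'a and n :: nat and x y :: "nat \<Rightarrow> nat \<Rightarrow> 'a"
  assumes n_pos: "0 < n"
    and x_mem: "i < n \<Longrightarrow> j < n \<Longrightarrow> x i j \<in> intertwiners S T"
    and y_mem: "i < n \<Longrightarrow> j < n \<Longrightarrow> y i j \<in> intertwiners T S"
    and xy: "i < n \<Longrightarrow> k < n \<Longrightarrow> (\<Sum>j<n. x i j * y j k) = (if i = k then 1 else 0)"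
    and yx: "i < n \<Longrightarrow> k < n \<Longrightarrow> (\<Sum>j<n. y i j * x j k) = (if i = k then 1 else 0)"
begin

abbreviation "A \<equiv> intertwiners S S"
abbreviation "H \<equiv> intertwiners S T"
abbreviation "K \<equiv> intertwiners T S"

text \<open>
  This is \<open>J H\<close>: it contains \<open>J H\<close> as \<open>H K\<close> is contained in \<open>A\<close>, and every \<open>h \<in> H\<close> is a combination
  of products \<open>(h k) x\<close> with \<open>k \<in> K\<close> and \<open>x \<in> H\<close> (\<open>expand_H\<close>). The description by pairing with \<open>K\<close>
  turns membership into a condition on elements of \<open>A\<close>.
\<close>

definition "H0 = {h \<in> H. \<forall>k\<in>K. h * k \<in> J}"

lemma H0D: "h \<in> H0 \<Longrightarrow> h \<in> H" "h \<in> H0 \<Longrightarrow> k \<in> K \<Longrightarrow> h * k \<in> J"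
  by (simp_all add: H0_def)

lemma H0_zero: "0 \<in> H0"
  by (simp add: H0_def intertwiners_zero radical(2))

lemma H0_add: "h \<in> H0 \<Longrightarrow> h' \<in> H0 \<Longrightarrow> h + h' \<in> H0"
  by (simp add: H0_def intertwiners_add distrib_right radical(3))

lemma H0_diff: "h \<in> H0 \<Longrightarrow> h' \<in> H0 \<Longrightarrow> h - h' \<in> H0"
  by (simp add: H0_def intertwiners_diff left_diff_distrib radical(6))

lemma H0_mult: "a \<in> A \<Longrightarrow> h \<in> H0 \<Longrightarrow> a * h \<in> H0"
  by (simp add: H0_def mult.assoc intertwiners_mult[of a S S h T] radical(4))

lemma H0_radical: "j \<in> J \<Longrightarrow> h \<in> H \<Longrightarrow> j * h \<in> H0"
  unfolding H0_def
  by (simp add: mult.assoc intertwiners_mult[OF radical(1)] intertwiners_mult[of h S T _ S]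
      radical_mult_right)

lemma H0_sum: "(\<And>i. i \<in> I \<Longrightarrow> f i \<in> H0) \<Longrightarrow> sum f I \<in> H0"
  by (induction I rule: infinite_finite_induct) (auto simp: H0_zero intro: H0_add)

lemma radical_sum: "(\<And>i. i \<in> I \<Longrightarrow> f i \<in> J) \<Longrightarrow> sum f I \<in> J"
  by (induction I rule: infinite_finite_induct) (auto simp: radical(2) intro: radical(3))

lemma expand_H: "l < n \<Longrightarrow> h = (\<Sum>k<n. (h * y l k) * x k l)"
  using yx[of l l] by (simp add: mult.assoc flip: sum_distrib_left)

lemma H0_iff:
  assumes h: "h \<in> H" and l: "l < n"
  shows "h \<in> H0 \<longleftrightarrow> (\<forall>k<n. h * y l k \<in> J)"
proof
  show "h \<in> H0 \<Longrightarrow> \<forall>k<n. h * y l k \<in> J" using H0D(2) y_mem l by simp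
  assume *: "\<forall>k<n. h * y l k \<in> J"
  have "(\<Sum>k<n. (h * y l k) * x k l) \<in> H0"
    by (intro H0_sum H0_radical x_mem l) (use * in simp_all)
  then show "h \<in> H0" using expand_H[OF l, of h] by simp
qed

text \<open>
  The composition \<open>A\<^sup>n \<rightarrow> H\<^sup>n \<rightarrow> A\<^sup>n\<close> of right multiplication by \<open>z\<close> with right multiplication by the
  matrix \<open>y\<close>. By \<open>through_contract\<close> the matrix \<open>x\<close> undoes the second step.
\<close>

definition through :: "'a \<Rightarrow> (nat \<Rightarrow> 'a) \<Rightarrow> nat \<Rightarrow> 'a" where
  "through z v = (\<lambda>k. \<Sum>i<n. v i * z * y i k)"

lemma row_endomorphism_through:
  assumes z: "z \<in> H"
  shows "row_endomorphism A len bound n (through z)"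
proof
  show "through z (\<lambda>i. v i + w i) = (\<lambda>i. through z v i + through z w i)" for v w
    by (simp add: through_def distrib_right sum.distrib)
  show "through z (\<lambda>i. r * v i) = (\<lambda>i. r * through z v i)" for r v
    by (simp add: through_def sum_distrib_left mult.assoc)
  have zy: "z * y i k \<in> A" if "i < n" "k < n" for i k
    using z y_mem[OF that] by (rule intertwiners_mult)
  show "through z v i \<in> A" if "\<And>i. i < n \<Longrightarrow> v i \<in> A" "i < n" for v i
    unfolding through_def mult.assoc
    by (intro intertwiners_sum intertwiners_mult[OF that(1) zy]) (use that(2) in simp_all)
  show "through z v i \<in> J" if "\<And>i. i < n \<Longrightarrow> v i \<in> J" "i < n" for v i
    unfolding through_def mult.assoc
    by (intro radical_sum radical_mult_right[OF that(1) zy]) (use that(2) in simp_all)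
qed

lemma through_contract:
  assumes l: "l < n"
  shows "(\<Sum>k<n. through z v k * x k l) = v l * z"
proof -
  have "(\<Sum>k<n. through z v k * x k l) = (\<Sum>i<n. \<Sum>k<n. v i * z * (y i k * x k l))"
    unfolding through_def sum_distrib_right by (subst sum.swap) (simp add: mult.assoc)
  also have "\<dots> = (\<Sum>i<n. if i = l then v i * z else 0)"
    by (intro sum.cong refl) (simp add: yx l flip: sum_distrib_left)
  also have "\<dots> = v l * z" using l by simp
  finally show ?thesis .
qed

text \<open>
  The hypothesis makes the endomorphism of \<open>z\<close> injective modulo \<open>J\<close>, so it is surjective. Hence the
  row \<open>h y\<^sub>0\<^sub>k\<close>, which is the image of \<open>(h, 0, ..., 0) \<in> H\<^sup>n\<close>, is hit; apply \<open>x\<close> to compare the first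
  entries in \<open>H\<^sup>n\<close>.
\<close>

lemma generates_if_annihilator_radical:
  assumes z: "z \<in> H" and ann: "\<And>a. a \<in> A \<Longrightarrow> a * z \<in> H0 \<Longrightarrow> a \<in> J" and h: "h \<in> H"
  obtains a where "a \<in> A" "h - a * z \<in> H0"
proof -
  interpret row_endomorphism A len bound n "through z"
    by (rule row_endomorphism_through[OF z])
  have inj: "\<forall>i<n. v i \<in> J" if v: "\<forall>i<n. v i \<in> A" "\<forall>i<n. through z v i \<in> J" for v
  proof (intro allI impI)
    fix l assume l: "l < n"
    have "(\<Sum>k<n. through z v k * x k l) \<in> H0"
      by (intro H0_sum H0_radical x_mem l) (use v(2) in simp_all)
    then show "v l \<in> J" using ann v(1) l by (simp add: through_contract)
  qed
  have hy: "\<forall>k<n. h * y 0 k \<in> A"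
    using intertwiners_mult[OF h y_mem[OF n_pos]] by simp
  obtain w where w: "\<forall>i<n. w i \<in> A" "\<forall>k<n. h * y 0 k - through z w k \<in> J"
    by (rule injective_imp_surjective[OF inj hy])
  have "(\<Sum>k<n. (h * y 0 k - through z w k) * x k 0) \<in> H0"
    by (intro H0_sum H0_radical x_mem n_pos) (use w(2) in simp_all)
  then have "h - w 0 * z \<in> H0"
    by (simp only: left_diff_distrib sum_subtractf through_contract[OF n_pos]
        expand_H[OF n_pos, of h, symmetric])
  moreover have "w 0 \<in> A" using w(1) n_pos by simp
  ultimately show ?thesis by (intro that)
qed

text \<open>
  As \<open>e\<close> kills \<open>z\<close>, the part \<open>e A z\<close> of \<open>A z\<close> is a quotient of \<open>e A (1 - e)\<close> and so is smaller than \<open>e A\<close>,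
  whereas \<open>e H\<close> is as large as \<open>e A\<close> because \<open>H\<^sup>n \<cong> A\<^sup>n\<close>. Instead of comparing dimensions, suppose
  that \<open>e H\<close> is covered by \<open>A z\<close>: then the endomorphism of \<open>z\<close> is onto the rows fixed by \<open>e\<close> modulo
  \<open>J\<close>, but its kernel contains the constant row \<open>e\<close>.
\<close>

lemma idempotent_part_not_covered:
  assumes z: "z \<in> H" and e: "e \<in> A" "e \<notin> J" "e * e - e \<in> J" and ez: "e * z \<in> H0"
  obtains h where "h \<in> H" "\<And>a. a \<in> A \<Longrightarrow> e * h - a * z \<notin> H0"
proof -
  interpret row_endomorphism A len bound n "through z"
    by (rule row_endomorphism_through[OF z])
  have "\<exists>h\<in>H. \<forall>a\<in>A. e * h - a * z \<notin> H0"
  proof (rule ccontr)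
    assume "\<not> ?thesis"
    then have "\<forall>h\<in>H. \<exists>a\<in>A. e * h - a * z \<in> H0" by simp
    then obtain \<alpha> where "\<forall>h\<in>H. \<alpha> h \<in> A \<and> e * h - \<alpha> h * z \<in> H0"
      unfolding bchoice_iff Bex_def by (elim exE)
    then have \<alpha>: "\<alpha> h \<in> A" "e * h - \<alpha> h * z \<in> H0" if "h \<in> H" for h
      using that by simp_all
    let ?E = "{v. \<forall>i<n. v i \<in> A \<and> e * v i - v i \<in> J}"
    have "\<forall>i<n. (\<lambda>_. e) i \<in> J"
    proof (rule kernel_trivial_on_surjective_part[of ?E])
      show "\<forall>i<n. v i \<in> A" if "v \<in> ?E" for v using that by simp
      show "(\<lambda>_. e) \<in> ?E" using e by simp
      show "\<forall>k<n. through z (\<lambda>_. e) k \<in> J"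
      proof (intro allI impI)
        fix k assume "k < n"
        then show "through z (\<lambda>_. e) k \<in> J"
          unfolding through_def by (intro radical_sum H0D(2)[OF ez] y_mem) simp_all
      qed
      fix v assume "v \<in> ?E"
      then have v: "v i \<in> A" "e * v i - v i \<in> J" if "i < n" for i using that by simp_all
      \<comment> \<open>The preimage of the row \<open>v\<close> under \<open>H\<^sup>n \<cong> A\<^sup>n\<close>; its entries are fixed by \<open>e\<close> modulo \<open>J H\<close>.\<close>
      define h where "h i = (\<Sum>k<n. v k * x k i)" for i
      define u where "u i = e * \<alpha> (h i)" for i
      have h: "h i \<in> H" if "i < n" for i
        unfolding h_def by (intro intertwiners_sum intertwiners_mult[OF v(1) x_mem]) (use that in simp_all)
      have uv: "u i * z - h i \<in> H0" if i: "i < n" for i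
      proof -
        have 1: "e * (e * h i - \<alpha> (h i) * z) \<in> H0" by (intro H0_mult e \<alpha> h i)
        have 2: "(e * e - e) * h i \<in> H0" by (intro H0_radical e h i)
        have "(\<Sum>k<n. (e * v k - v k) * x k i) \<in> H0"
          by (intro H0_sum H0_radical x_mem i v) simp_all
        moreover have "(\<Sum>k<n. (e * v k - v k) * x k i) = e * h i - h i"
          by (simp add: h_def left_diff_distrib sum_subtractf sum_distrib_left mult.assoc)
        ultimately have 3: "e * h i - h i \<in> H0" by simp
        have "((e * e - e) * h i + (e * h i - h i)) - e * (e * h i - \<alpha> (h i) * z) \<in> H0"
          by (rule H0_diff[OF H0_add[OF 2 3] 1])
        moreover have "((e * e - e) * h i + (e * h i - h i)) - e * (e * h i - \<alpha> (h i) * z) = u i * z - h i"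
          by (simp add: u_def left_diff_distrib right_diff_distrib mult.assoc)
        ultimately show ?thesis by simp
      qed
      have uE: "u \<in> ?E"
      proof (intro CollectI allI impI conjI)
        fix i assume i: "i < n"
        show "u i \<in> A" unfolding u_def by (intro intertwiners_mult[OF e(1)] \<alpha> h i)
        have "(e * e - e) * \<alpha> (h i) \<in> J" by (intro radical_mult_right e \<alpha> h i)
        then show "e * u i - u i \<in> J" by (simp add: u_def left_diff_distrib mult.assoc)
      qed
      have "\<forall>k<n. through z u k - v k \<in> J"
      proof (intro allI impI)
        fix k assume k: "k < n"
        have "(\<Sum>i<n. h i * y i k) = (\<Sum>j<n. \<Sum>i<n. v j * (x j i * y i k))"
          unfolding h_def sum_distrib_right by (subst sum.swap) (simp add: mult.assoc)
        also have "\<dots> = (\<Sum>j<n. if j = k then v j else 0)"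
          by (intro sum.cong refl) (simp add: xy k flip: sum_distrib_left)
        also have "\<dots> = v k" using k by simp
        finally have "through z u k - v k = (\<Sum>i<n. (u i * z - h i) * y i k)"
          by (simp add: through_def left_diff_distrib sum_subtractf)
        also have "\<dots> \<in> J"
          by (intro radical_sum H0D(2)[OF uv] y_mem k) simp_all
        finally show "through z u k - v k \<in> J" .
      qed
      then show "\<exists>u\<in>?E. \<forall>k<n. through z u k - v k \<in> J" using uE by (rule bexI)
    qed
    then show False using e(2) n_pos by simp
  qed
  then obtain h where h: "h \<in> H" "\<forall>a\<in>A. e * h - a * z \<notin> H0" by (elim bexE)
  show ?thesis by (rule that[OF h(1)]) (rule h(2)[rule_format])
qed

text \<open>
  The image of \<open>A z + J H\<close> under the embedding of \<open>H\<close> as the first summand of \<open>H\<^sup>n \<cong> A\<^sup>n\<close>. The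
  length of this submodule measures how much of \<open>H\<close> is generated by \<open>z\<close>.
\<close>

lemma row_submodule_generated:
  assumes z: "z \<in> H"
  shows "row_submodule n {v. \<exists>a\<in>A. \<forall>k<n. v k - a * z * y 0 k \<in> J}" (is "row_submodule n ?N")
proof (rule row_submoduleI)
  have zy: "z * y 0 k \<in> A" if "k < n" for k
    using z y_mem[OF n_pos that] by (rule intertwiners_mult)
  have N: "v \<in> ?N" if "a \<in> A" "\<And>k. k < n \<Longrightarrow> v k - a * z * y 0 k \<in> J" for v a
    using that by (intro CollectI bexI[of _ a]) simp_all
  have "(\<lambda>k. 0) \<in> ?N" by (rule N[of 0]) (simp_all add: zero_mem radical(2))
  then show "?N \<noteq> {}" by (metis empty_iff)
  show "v k \<in> A" if V: "v \<in> ?N" "k < n" for v k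
  proof -
    obtain a where a: "a \<in> A" "\<forall>k<n. v k - a * z * y 0 k \<in> J" using V(1) by blast
    have "a * (z * y 0 k) \<in> A" by (intro mult_mem a zy V)
    moreover have "v k - a * z * y 0 k \<in> A" using radical(1) a(2) V(2) by simp
    ultimately have "(v k - a * z * y 0 k) + a * (z * y 0 k) \<in> A" by (intro add_mem)
    then show ?thesis by (simp add: mult.assoc)
  qed
  show "(\<lambda>i. v i + w i) \<in> ?N" if V: "v \<in> ?N" "w \<in> ?N" for v w
  proof -
    obtain a where a: "a \<in> A" "\<forall>k<n. v k - a * z * y 0 k \<in> J" using V(1) by blast
    obtain b where b: "b \<in> A" "\<forall>k<n. w k - b * z * y 0 k \<in> J" using V(2) by blast
    show ?thesis
    proof (rule N)
      show "a + b \<in> A" by (rule add_mem[OF a(1) b(1)])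
      fix k assume "k < n"
      then have "(v k - a * z * y 0 k) + (w k - b * z * y 0 k) \<in> J"
        by (intro radical(3)[OF a(2)[rule_format] b(2)[rule_format]])
      then show "v k + w k - (a + b) * z * y 0 k \<in> J" by (simp add: distrib_right algebra_simps)
    qed
  qed
  show "(\<lambda>i. r * v i) \<in> ?N" if V: "r \<in> A" "v \<in> ?N" for r v
  proof -
    obtain a where a: "a \<in> A" "\<forall>k<n. v k - a * z * y 0 k \<in> J" using V(2) by blast
    show ?thesis
    proof (rule N)
      show "r * a \<in> A" by (rule mult_mem[OF V(1) a(1)])
      fix k assume "k < n"
      then have "r * (v k - a * z * y 0 k) \<in> J"
        by (intro radical(4)[OF V(1) a(2)[rule_format]])
      then show "r * v k - r * a * z * y 0 k \<in> J" by (simp add: right_diff_distrib mult.assoc)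
    qed
  qed
  show "w \<in> ?N" if V: "v \<in> ?N" "\<And>i. i < n \<Longrightarrow> w i - v i \<in> J" for v w
  proof -
    obtain a where a: "a \<in> A" "\<forall>k<n. v k - a * z * y 0 k \<in> J" using V(1) by blast
    show ?thesis
    proof (rule N)
      show "a \<in> A" by (rule a(1))
      fix k assume "k < n"
      then have "(w k - v k) + (v k - a * z * y 0 k) \<in> J"
        by (intro radical(3)[OF V(2) a(2)[rule_format]])
      then show "w k - a * z * y 0 k \<in> J" by simp
    qed
  qed
qed

text \<open>
  Take \<open>z\<close> that generates the most. If its annihilator contained an idempotent \<open>e \<notin> J\<close>, then for \<open>e h\<close>
  outside of \<open>A z + J H\<close> both \<open>z \<equiv> (1 - e) (z + e h)\<close> and \<open>e h \<equiv> e (z + e h)\<close> would be multiples of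
  \<open>z + e h\<close>, which would therefore generate more.
\<close>

lemma exists_annihilator_radical:
  obtains z where "z \<in> H" "\<And>a. a \<in> A \<Longrightarrow> a * z \<in> H0 \<Longrightarrow> a \<in> J"
proof -
  let ?N = "\<lambda>z. {v. \<exists>a\<in>A. \<forall>k<n. v k - a * z * y 0 k \<in> J}"
  obtain l c where lc: "(\<forall>N. row_submodule n N \<longrightarrow> l N \<le> (c::nat)) \<and>
      (\<forall>N N'. row_submodule n N \<longrightarrow> row_submodule n N' \<longrightarrow> N \<subset> N' \<longrightarrow> l N < l N')"
    using row_length[of n] by (elim exE)
  note l = lc[THEN conjunct1, rule_format] lc[THEN conjunct2, rule_format]
  have "\<exists>z. z \<in> H \<and> (\<forall>z'. z' \<in> H \<longrightarrow> l (?N z') \<le> l (?N z))"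
  proof (rule ex_has_greatest_nat)
    show "0 \<in> H" by (rule intertwiners_zero)
    show "\<forall>z. z \<in> H \<longrightarrow> l (?N z) < Suc c"
      using l(1)[OF row_submodule_generated] by (simp add: less_Suc_eq_le)
  qed
  then obtain z where z: "z \<in> H" and max: "\<forall>z'. z' \<in> H \<longrightarrow> l (?N z') \<le> l (?N z)"
    by (elim exE conjE)
  have "{a \<in> A. a * z \<in> H0} = J"
  proof (rule ccontr)
    assume ne: "{a \<in> A. a * z \<in> H0} \<noteq> J"
    have li: "left_ideal {a \<in> A. a * z \<in> H0} R"
      by (rule left_idealI)
        (auto simp: zero_mem H0_zero add_mem mult_mem distrib_right mult.assoc intro: H0_add H0_mult)
    have J: "J \<subseteq> {a \<in> A. a * z \<in> H0}"
    proof
      fix a assume "a \<in> J"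
      then show "a \<in> {a \<in> A. a * z \<in> H0}" using radical(1) H0_radical z by simp
    qed
    obtain e where "e \<in> {a \<in> A. a * z \<in> H0}" and e': "e \<notin> J" "e * e - e \<in> J"
      by (rule exists_idempotent_mod_radical[OF li J ne])
    then have e: "e \<in> A" "e * z \<in> H0" by simp_all
    obtain h where h: "h \<in> H" "\<And>a. a \<in> A \<Longrightarrow> e * h - a * z \<notin> H0"
      by (rule idempotent_part_not_covered[OF z e(1) e' e(2)]) (rule that)
    define z' where "z' = z + e * h"
    have eh: "e * h \<in> H" using e(1) h(1) by (rule intertwiners_mult)
    have z': "z' \<in> H" unfolding z'_def using z eh by (rule intertwiners_add)
    have 1: "(1 - e) * z' - z \<in> H0"
    proof -
      have "0 - e * z - (e * e - e) * h \<in> H0" by (intro H0_diff H0_zero e H0_radical e' h)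
      then show ?thesis
        by (simp add: z'_def left_diff_distrib distrib_left distrib_right mult.assoc algebra_simps)
    qed
    have 2: "e * h - e * z' \<in> H0"
    proof -
      have "0 - e * z - (e * e - e) * h \<in> H0" by (intro H0_diff H0_zero e H0_radical e' h)
      then show ?thesis
        by (simp add: z'_def left_diff_distrib distrib_left distrib_right mult.assoc algebra_simps)
    qed
    have sub: "?N z \<subseteq> ?N z'"
    proof
      fix v assume "v \<in> ?N z"
      then obtain a where a: "a \<in> A" "\<forall>k<n. v k - a * z * y 0 k \<in> J" by blast
      show "v \<in> ?N z'"
      proof (intro CollectI bexI allI impI)
        show "a * (1 - e) \<in> A" by (intro mult_mem diff_mem one_mem a e)
        fix k assume k: "k < n"
        have "a * ((1 - e) * z' - z) * y 0 k \<in> J"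
          by (intro H0D(2) H0_mult a 1 y_mem k n_pos)
        then have "(v k - a * z * y 0 k) - a * ((1 - e) * z' - z) * y 0 k \<in> J"
          using a(2) k by (intro radical(6)[OF a(2)[rule_format, OF k]])
        then show "v k - a * (1 - e) * z' * y 0 k \<in> J"
          by (simp add: right_diff_distrib left_diff_distrib mult.assoc)
      qed
    qed
    have new: "(\<lambda>k. e * h * y 0 k) \<in> ?N z'"
    proof (intro CollectI bexI allI impI)
      fix k assume k: "k < n"
      have "(e * h - e * z') * y 0 k \<in> J" by (intro H0D(2) 2 y_mem k n_pos)
      then show "e * h * y 0 k - e * z' * y 0 k \<in> J" by (simp add: left_diff_distrib)
    qed (rule e(1))
    have "(\<lambda>k. e * h * y 0 k) \<notin> ?N z"
    proof
      assume "(\<lambda>k. e * h * y 0 k) \<in> ?N z"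
      then obtain a where a: "a \<in> A" "\<forall>k<n. (e * h - a * z) * y 0 k \<in> J"
        by (auto simp: left_diff_distrib)
      have "e * h - a * z \<in> H" by (intro intertwiners_diff eh intertwiners_mult[OF a(1) z])
      then have "e * h - a * z \<in> H0" using H0_iff[OF _ n_pos] a(2) by simp
      then show False using h(2)[OF a(1)] by simp
    qed
    then have "\<not> ?N z' \<subseteq> ?N z" using subsetD[OF _ new] by (rule contrapos_nn)
    with sub have "?N z \<subset> ?N z'" unfolding less_le_not_le by (rule conjI)
    then have "l (?N z) < l (?N z')"
      by (intro l(2) row_submodule_generated z z')
    then show False using max z' by (simp add: not_le[symmetric])
  qed
  then have "a \<in> J" if "a \<in> A" "a * z \<in> H0" for a using that by auto
  then show ?thesis by (rule that[OF z])
qed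

text \<open>
  For \<open>b\<close> in the commutant of \<open>T\<close> the product \<open>h (b k)\<close> lies in \<open>J\<close>, so \<open>1 - h (b k)\<close> has an inverse
  \<open>u\<close> in \<open>A\<close>, and then \<open>1 + b k u h\<close> inverts \<open>1 - b k h\<close>.
\<close>

lemma quasi_regular_mult_H0:
  assumes k: "k \<in> K" and h: "h \<in> H0"
  shows "k * h \<in> quasi_regular T"
  unfolding quasi_regular_def mem_Collect_eq
proof (intro conjI ballI)
  show "k * h \<in> intertwiners T T" using k H0D(1)[OF h] by (rule intertwiners_mult)
  fix b assume b: "b \<in> intertwiners T T"
  have bk: "b * k \<in> K" using b k by (rule intertwiners_mult)
  obtain u where u: "u \<in> A" "u * (1 - h * (b * k)) = 1" "(1 - h * (b * k)) * u = 1"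
    by (rule radical_inverse[OF H0D(2)[OF h bk]])
  let ?w = "1 + b * k * (u * h)"
  show "\<exists>w\<in>intertwiners T T. w * (1 - b * (k * h)) = 1 \<and> (1 - b * (k * h)) * w = 1"
  proof (intro bexI conjI)
    have "u * h - u * (h * (b * k)) * h = u * (1 - h * (b * k)) * h"
      by (simp add: left_diff_distrib right_diff_distrib)
    then have 1: "u * h - u * (h * (b * k)) * h = h" unfolding u(2) by simp
    have "?w * (1 - b * (k * h)) = 1 - b * k * h + b * k * (u * h - u * (h * (b * k)) * h)"
      by (simp add: algebra_simps)
    then show "?w * (1 - b * (k * h)) = 1" unfolding 1 by simp
    have "u * h - h * (b * k) * u * h = (1 - h * (b * k)) * u * h"
      by (simp add: left_diff_distrib right_diff_distrib)
    then have 2: "u * h - h * (b * k) * u * h = h" unfolding u(3) by simp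
    have "(1 - b * (k * h)) * ?w = 1 - b * k * h + b * k * (u * h - h * (b * k) * u * h)"
      by (simp add: algebra_simps)
    then show "(1 - b * (k * h)) * ?w = 1" unfolding 2 by simp
    show "?w \<in> intertwiners T T"
      by (intro intertwiners_add intertwiners_one intertwiners_mult[OF bk]
          intertwiners_mult[OF u(1)] H0D(1)[OF h])
  qed
qed

text \<open>
  As \<open>z\<close> generates \<open>H\<close> modulo \<open>J H\<close>, substituting \<open>x\<^sub>j\<^sub>0 \<equiv> a\<^sub>j z\<close> into \<open>1 = \<Sum>\<^sub>j y\<^sub>0\<^sub>j x\<^sub>j\<^sub>0\<close> shows that \<open>c z\<close> with
  \<open>c = \<Sum>\<^sub>j y\<^sub>0\<^sub>j a\<^sub>j\<close> is \<open>1\<close> up to a quasi-regular element, so \<open>z\<close> has a left inverse \<open>z'\<close>. The idempotent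
  \<open>1 - z z'\<close> annihilates \<open>z\<close> and so lies in \<open>J\<close>, but an idempotent in the radical is zero.
\<close>

theorem invertible_intertwiner:
  obtains z z' where "z \<in> H" "z * z' = 1" "z' * z = 1"
proof -
  obtain z where z: "z \<in> H" and ann: "\<And>a. a \<in> A \<Longrightarrow> a * z \<in> H0 \<Longrightarrow> a \<in> J"
    by (rule exists_annihilator_radical) (rule that)
  have "\<exists>a\<in>A. x j 0 - a * z \<in> H0" if j: "j < n" for j
    by (rule generates_if_annihilator_radical[OF z ann x_mem[OF j n_pos]]) (auto intro: bexI)
  then have "\<forall>j\<in>{..<n}. \<exists>a. a \<in> A \<and> x j 0 - a * z \<in> H0"
    unfolding Bex_def by simp
  then obtain a where "\<forall>j\<in>{..<n}. a j \<in> A \<and> x j 0 - a j * z \<in> H0"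
    unfolding bchoice_iff by (elim exE)
  then have a: "a j \<in> A" "x j 0 - a j * z \<in> H0" if "j < n" for j
    using that by simp_all
  define c where "c = (\<Sum>j<n. y 0 j * a j)"
  have c: "c \<in> K"
    unfolding c_def by (intro intertwiners_sum intertwiners_mult[OF y_mem a(1)]) (simp_all add: n_pos)
  let ?s = "\<Sum>j<n. y 0 j * (x j 0 - a j * z)"
  have s: "?s \<in> quasi_regular T"
    by (intro quasi_regular_sum quasi_regular_mult_H0 y_mem n_pos a) simp_all
  have cz: "1 - ?s = c * z"
    by (simp add: right_diff_distrib sum_subtractf yx n_pos c_def sum_distrib_right mult.assoc)
  obtain w where w: "w \<in> intertwiners T T" "w * (1 - 1 * ?s) = 1"
    using quasi_regularD(2)[OF s intertwiners_one] by (elim bexE conjE)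
  define z' where "z' = w * c"
  have z'z: "z' * z = 1" using w(2) unfolding mult_1_left cz by (simp add: z'_def mult.assoc)
  have zz': "z * z' \<in> A"
    unfolding z'_def by (intro intertwiners_mult[OF z] intertwiners_mult[OF w(1) c])
  have "1 - z * z' \<in> J"
  proof (rule ann)
    show "1 - z * z' \<in> A" by (intro diff_mem one_mem zz')
    show "(1 - z * z') * z \<in> H0" using z'z H0_zero by (simp add: left_diff_distrib mult.assoc)
  qed
  then obtain u where u: "(1 - (1 - z * z')) * u = 1" by (rule radical_inverse)
  have "(1 - z * z') * (z * z') = z * z' - z * (z' * z) * z'"
    by (simp only: left_diff_distrib mult_1_left mult.assoc)
  then have "(1 - z * z') * (z * z') * u = 0" unfolding z'z by simp
  then have "(1 - z * z') * (z * z' * u) = 0" by (simp only: mult.assoc)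
  then have "z * z' = 1" using u by simp
  then show ?thesis using z'z by (intro that[OF z])
qed

end

section \<open>From finite dimension to finite length\<close>

context ring
begin

text \<open>
  The length of \<open>F\<close> is the largest length of an independent list in \<open>F\<close>, so that no basis of \<open>F\<close> has
  to be produced: if \<open>F\<close> is a proper subspace of \<open>G\<close>, any element of \<open>G\<close> outside \<open>F\<close> prolongs a longest
  independent list in \<open>F\<close>.
\<close>

lemma subspace_length:
  assumes K: "subfield K R" and E: "dimension d K E"
  obtains l :: "'a set \<Rightarrow> nat" where
    "\<And>F. F \<subseteq> E \<Longrightarrow> l F \<le> d"
    "\<And>F G. \<lbrakk>subgroup F (add_monoid R); \<forall>k\<in>K. \<forall>v\<in>F. k \<otimes> v \<in> F; F \<subset> G; G \<subseteq> E\<rbrakk>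
      \<Longrightarrow> l F < l G"
proof -
  define l where "l F = Max {length Us |Us. independent K Us \<and> set Us \<subseteq> F}" for F
  have le: "length Us \<le> d" if "F \<subseteq> E" "independent K Us" "set Us \<subseteq> F" for F Us
    using independent_length_le_dimension[OF K E that(2)] that(1,3) by simp
  have fin: "finite {length Us |Us. independent K Us \<and> set Us \<subseteq> F}" if "F \<subseteq> E" for F
    by (rule finite_subset[of _ "{..d}"]) (use le[OF that] in auto)
  have ne: "{length Us |Us. independent K Us \<and> set Us \<subseteq> F} \<noteq> {}" for F
    using li_Nil[of K] by fastforce
  have "l F \<le> d" if "F \<subseteq> E" for F
    unfolding l_def using fin[OF that] ne le[OF that] by (subst Max_le_iff) auto
  moreover have "l F < l G"
    if F: "subgroup F (add_monoid R)" "\<forall>k\<in>K. \<forall>v\<in>F. k \<otimes> v \<in> F"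
      and FG: "F \<subset> G" "G \<subseteq> E" for F G
  proof -
    have FE: "F \<subseteq> E" using FG by blast
    have "l F \<in> {length Us |Us. independent K Us \<and> set Us \<subseteq> F}"
      unfolding l_def by (rule Max_in[OF fin[OF FE] ne])
    then obtain Us where Us: "l F = length Us" "independent K Us" "set Us \<subseteq> F" by blast
    have FR: "F \<subseteq> carrier R" using subgroup.subset[OF F(1)] by simp
    have "Span K Us \<subseteq> F"
    proof (rule Span_min[OF K _ F(1)])
      show "set Us \<subseteq> carrier R" using Us(3) FR by blast
      show "K <#> set Us \<subseteq> F"
        using F(2) Us(3) unfolding set_mult_def by blast
    qed
    moreover obtain u where u: "u \<in> G" "u \<notin> F" using FG(1) by blast
    moreover have "E \<subseteq> carrier R" by (rule space_subgroup_props(1)[OF K E])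
    ultimately have "independent K (u # Us)"
      using FG(2) by (intro li_Cons Us(2)) auto
    then have "length (u # Us) \<in> {length Us |Us. independent K Us \<and> set Us \<subseteq> G}"
      using u(1) Us(3) FG(1) by (intro CollectI exI[of _ "u # Us"]) auto
    then have "length (u # Us) \<le> l G"
      unfolding l_def by (rule Max_ge[OF fin[OF FG(2)]])
    then show ?thesis using Us(1) by simp
  qed
  ultimately show ?thesis using that by blast
qed

end

context unital_subring
begin

lemma ideal_radical: "ideal J R"
proof (rule idealI[OF ring_R])
  show "subgroup J (add_monoid R)"
    using left_ideal_radical unfolding left_ideal_def by (elim conjE additive_subgroup.a_subgroup)
qed (simp_all add: radical(4) radical_mult_right)

lemma one_notin_radical: "1 \<notin> J"
proof
  assume "1 \<in> J"
  then obtain u where "u \<in> A" "u * (1 - 1) = 1" by (rule radical_left_inverse)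
  then show False by simp
qed

lemma coset_eq_iff:
  assumes "a \<in> A" "b \<in> A"
  shows "J +>\<^bsub>R\<^esub> a = J +>\<^bsub>R\<^esub> b \<longleftrightarrow> a - b \<in> J"
proof -
  have minus: "a \<ominus>\<^bsub>R\<^esub> b = a - b"
    using a_inv_R[OF assms(2)] by (simp add: a_minus_def)
  have "a \<ominus>\<^bsub>R\<^esub> b \<in> J \<longleftrightarrow> J +>\<^bsub>R\<^esub> a = J +>\<^bsub>R\<^esub> b"
    by (rule ring.quotient_eq_iff_same_a_r_cos[OF ring_R ideal_radical]) (simp_all add: assms)
  then show ?thesis unfolding minus by (rule sym)
qed

text \<open>
  A left ideal of \<open>A\<close> is mapped to a subspace of \<open>A / J\<close>, since the scalars are classes of elements of
  \<open>A\<close>; above \<open>J\<close> this map preserves strict inclusions.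
\<close>

lemma finite_length_if_finite_dimension:
  assumes K: "subfield K (R Quot J)"
    and dim: "ring.finite_dimension (R Quot J) K (carrier (R Quot J))"
  obtains len d where "finite_length_mod_radical A len d"
proof -
  let ?Q = "R Quot J" and ?c = "\<lambda>a. J +>\<^bsub>R\<^esub> a"
  interpret Q: ring ?Q by (rule ideal.quotient_is_ring[OF ideal_radical])
  interpret hom: ring_hom_ring R ?Q ?c by (rule ideal.rcos_ring_hom_ring[OF ideal_radical])
  have Q_mult: "?c a \<otimes>\<^bsub>?Q\<^esub> ?c b = ?c (a * b)" if "a \<in> A" "b \<in> A" for a b
    using hom.hom_mult[of a b] that by simp
  have Q_carrier: "carrier ?Q = ?c ` A"
    by (auto simp: FactRing_def A_RCOSETS_defs a_r_coset_def)
  obtain d where d: "Q.dimension d K (carrier ?Q)"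
    using dim unfolding Q.finite_dimension_def by (elim exE)
  obtain l where l: "\<And>F. F \<subseteq> carrier ?Q \<Longrightarrow> l F \<le> d"
    and l': "\<And>F G. \<lbrakk>subgroup F (add_monoid ?Q); \<forall>k\<in>K. \<forall>v\<in>F. k \<otimes>\<^bsub>?Q\<^esub> v \<in> F; F \<subset> G; G \<subseteq> carrier ?Q\<rbrakk>
      \<Longrightarrow> l F < (l G :: nat)"
    by (rule Q.subspace_length[OF K d]) (rule that)
  have sub: "?c ` L \<subseteq> carrier ?Q" if "left_ideal L R" for L
    unfolding Q_carrier using left_idealD(1)[OF that] by (intro image_mono subsetI)
  have "finite_length_mod_radical A (\<lambda>L. l (?c ` L)) d"
  proof
    show "l (?c ` L) \<le> d" if "left_ideal L R" for L
      by (intro l sub that)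
    fix L M assume L: "left_ideal L R" and M: "left_ideal M R" and "J \<subseteq> L" "L \<subset> M"
    show "l (?c ` L) < l (?c ` M)"
    proof (rule l')
      show "subgroup (?c ` L) (add_monoid ?Q)"
        using L unfolding left_ideal_def
        by (intro hom.img_is_add_subgroup additive_subgroup.a_subgroup) (rule conjunct1)
      show "\<forall>k\<in>K. \<forall>v\<in>?c ` L. k \<otimes>\<^bsub>?Q\<^esub> v \<in> ?c ` L"
      proof (intro ballI)
        fix k v assume "k \<in> K" "v \<in> ?c ` L"
        obtain b where b: "v = ?c b" "b \<in> L" using \<open>v \<in> ?c ` L\<close> by (rule imageE)
        have "k \<in> ?c ` A"
          using subringE(1)[OF subfieldE(1)[OF K]] \<open>k \<in> K\<close> Q_carrier by auto
        then obtain a where a: "k = ?c a" "a \<in> A" by (rule imageE)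
        have "k \<otimes>\<^bsub>?Q\<^esub> v = ?c (a * b)"
          unfolding a b by (rule Q_mult[OF a(2) left_idealD(1)[OF L b(2)]])
        then show "k \<otimes>\<^bsub>?Q\<^esub> v \<in> ?c ` L"
          using left_idealD(4)[OF L a(2) b(2)] by (rule image_eqI)
      qed
      show "?c ` M \<subseteq> carrier ?Q" by (rule sub[OF M])
      have "?c ` L \<subseteq> ?c ` M" using \<open>L \<subset> M\<close> by (intro image_mono) (rule psubset_imp_subset)
      moreover have "\<not> ?c ` M \<subseteq> ?c ` L"
      proof
        assume sub: "?c ` M \<subseteq> ?c ` L"
        obtain m where m: "m \<in> M" "m \<notin> L" 
          using psubset_imp_ex_mem[OF \<open>L \<subset> M\<close>] by (elim exE DiffE)
        have "?c m \<in> ?c ` L" using sub m(1) by (rule subsetD[OF _ imageI])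
        then obtain b where b: "?c m = ?c b" "b \<in> L" by (rule imageE)
        have "m - b \<in> J"
          using b(1) coset_eq_iff[OF left_idealD(1)[OF M m(1)] left_idealD(1)[OF L b(2)]] by simp
        then have "(m - b) + b \<in> L" 
          by (rule left_idealD(3)[OF L subsetD[OF \<open>J \<subseteq> L\<close>] b(2)])
        then show False using m(2) by simp
      qed
      ultimately show "?c ` L \<subset> ?c ` M" unfolding less_le_not_le by (rule conjI)
    qed
  qed
  then show ?thesis by (rule that)
qed

end

lemma scaleC_one: "1 *\<^sub>C (a :: 'a::unital_banach_algebra) = a"
  using scaleR_scaleC[of 1 a] by simp

text \<open>
  The scalars are the image of the complex numbers under a ring homomorphism, which is a field
  because \<open>1 \<notin> J\<close>.
\<close>

lemma subfield_quotient_scalars: "subfield (quotient_scalars T) (commutant_quotient T)"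
proof -
  let ?A = "intertwiners T T"
  interpret unital_subring ?A by (rule unital_subring_intertwiners)
  have com: "relative_commutant T = R"
    by (simp add: relative_commutant_def intertwiners_def)
  let ?Q = "R Quot J" and ?c = "\<lambda>a. J +>\<^bsub>R\<^esub> a"
  interpret hom: ring_hom_ring R ?Q ?c by (rule ideal.rcos_ring_hom_ring[OF ideal_radical])
  have mem: "c *\<^sub>C 1 \<in> ?A" for c
    by (simp add: intertwiners_def mult_scaleC_left mult_scaleC_right)
  have "ring_hom_ring class_ring R (\<lambda>c. c *\<^sub>C 1)"
    by (rule ring_hom_ringI[OF class_ring.ring_axioms ring_R])
      (simp_all add: mem mult_scaleC_left scaleC_scaleC scaleC_add_left scaleC_one)
  then have "(\<lambda>c. c *\<^sub>C 1) \<in> Ring.ring_hom (class_ring :: complex ring) R"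
    by (rule ring_hom_ring.homh)
  then have "?c \<circ> (\<lambda>c. c *\<^sub>C 1) \<in> Ring.ring_hom (class_ring :: complex ring) ?Q"
    using hom.homh by (rule ring_hom_trans)
  then interpret scal: ring_hom_ring "class_ring :: complex ring" ?Q "?c \<circ> (\<lambda>c. c *\<^sub>C 1)"
    by (rule ring_hom_ringI2[OF class_ring.ring_axioms hom.S.ring_axioms])
  have "\<one>\<^bsub>?Q\<^esub> \<noteq> \<zero>\<^bsub>?Q\<^esub>"
  proof
    assume "\<one>\<^bsub>?Q\<^esub> = \<zero>\<^bsub>?Q\<^esub>"
    then have "?c 1 = ?c 0"
      using hom.hom_one hom.hom_zero by simp
    then show False using coset_eq_iff[OF one_mem zero_mem] one_notin_radical by simp
  qed
  moreover have "field (class_ring :: complex ring)" by (rule class_field)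
  then have "subfield UNIV (class_ring :: complex ring)"
    using field.carrier_is_subfield by fastforce
  ultimately have "subfield ((?c \<circ> (\<lambda>c. c *\<^sub>C 1)) ` UNIV) ?Q"
    by (intro scal.img_is_subfield(2))
  then show ?thesis
    by (simp add: quotient_scalars_def commutant_quotient_def com image_comp)
qed

lemma finite_length_commutant:
  assumes "ess_finite_dim_commutant T"
  obtains len d where "finite_length_mod_radical (intertwiners T T) len d"
proof -
  interpret unital_subring "intertwiners T T" by (rule unital_subring_intertwiners)
  have com: "relative_commutant T = R"
    by (simp add: relative_commutant_def intertwiners_def)
  show ?thesis
  proof (rule finite_length_if_finite_dimension)
    show "subfield (quotient_scalars T) (R Quot J)"
      using subfield_quotient_scalars[of T] unfolding commutant_quotient_def com .
    show "ring.finite_dimension (R Quot J) (quotient_scalars T) (carrier (R Quot J))"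
      using assms unfolding ess_finite_dim_commutant_def commutant_quotient_def com .
  qed (rule that)
qed

section \<open>Similarity of amplifications\<close>

lemma intertwining_matrix_entries:
  assumes "M \<in> carrier_mat n n" "mat_diag n (\<lambda>_. S) * M = M * mat_diag n (\<lambda>_. T)"
    and "i < n" "j < n"
  shows "M $$ (i, j) \<in> intertwiners S T"
  using arg_cong[OF assms(2), of "\<lambda>N. N $$ (i, j)"] assms(1,3,4)
  by (simp add: mat_diag_mult_left mat_diag_mult_right intertwiners_def)

lemma inverse_matrix_entries:
  assumes "M \<in> carrier_mat n n" "N \<in> carrier_mat n n" "M * N = 1\<^sub>m n" "i < n" "k < n"
  shows "(\<Sum>j<n. M $$ (i, j) * N $$ (j, k)) = (if i = k then 1 else 0)"
  using arg_cong[OF assms(3), of "\<lambda>P. P $$ (i, k)"] assms(1,2,4,5)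
  by (simp add: scalar_prod_def atLeast0LessThan)

theorem theorem5p13:
  fixes T\<^sub>1 T\<^sub>2 :: "'a::unital_banach_algebra" and n :: nat
  assumes "n \<ge> 1"
    and "similar_in (ring_mat TYPE('a) n ()) (mat_diag n (\<lambda>_. T\<^sub>1)) (mat_diag n (\<lambda>_. T\<^sub>2))"
    and "ess_finite_dim_commutant T\<^sub>1"
  shows "similar_in (class_ring :: 'a ring) T\<^sub>1 T\<^sub>2"
proof -
  let ?N = "ring_mat TYPE('a) n ()" and ?D = "\<lambda>T. mat_diag n (\<lambda>_. T)"
  interpret N: semiring ?N by (rule semiring_mat)
  obtain X where X: "X \<in> Units ?N" "?D T\<^sub>2 = inv\<^bsub>?N\<^esub> X \<otimes>\<^bsub>?N\<^esub> ?D T\<^sub>1 \<otimes>\<^bsub>?N\<^esub> X"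
    using assms(2) unfolding similar_in_def by (elim conjE bexE)
  define Y where "Y = inv\<^bsub>?N\<^esub> X"
  have c: "X \<in> carrier_mat n n" "Y \<in> carrier_mat n n"
    using N.Units_closed[OF X(1)] N.Units_inv_closed[OF X(1)]
    by (simp_all add: ring_mat_simps Y_def)
  have inv: "X * Y = 1\<^sub>m n" "Y * X = 1\<^sub>m n"
    using N.Units_r_inv[OF X(1)] N.Units_l_inv[OF X(1)] by (simp_all add: ring_mat_simps Y_def)
  have D: "?D T \<in> carrier_mat n n" for T :: 'a by simp
  have sim: "?D T\<^sub>2 = Y * ?D T\<^sub>1 * X"
    using X(2) by (simp add: ring_mat_simps Y_def)
  have "X * ?D T\<^sub>2 = (X * Y) * (?D T\<^sub>1 * X)"
    unfolding sim assoc_mult_mat[OF c(2) D c(1)]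
    by (rule assoc_mult_mat[OF c mult_carrier_mat[OF D c(1)], symmetric])
  then have DX: "?D T\<^sub>1 * X = X * ?D T\<^sub>2"
    unfolding inv left_mult_one_mat[OF mult_carrier_mat[OF D c(1)]] by (rule sym)
  have "?D T\<^sub>2 * Y = (Y * ?D T\<^sub>1) * (X * Y)"
    unfolding sim by (rule assoc_mult_mat[OF mult_carrier_mat[OF c(2) D] c])
  then have DY: "?D T\<^sub>2 * Y = Y * ?D T\<^sub>1"
    unfolding inv right_mult_one_mat[OF mult_carrier_mat[OF c(2) D]] .
  obtain len d where "finite_length_mod_radical (intertwiners T\<^sub>1 T\<^sub>1) len d"
    using assms(3) by (rule finite_length_commutant)
  then interpret finite_length_mod_radical "intertwiners T\<^sub>1 T\<^sub>1" len d .
  interpret amplified_similarity T\<^sub>1 len d T\<^sub>2 n "\<lambda>i j. X $$ (i, j)" "\<lambda>i j. Y $$ (i, j)"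
    by unfold_locales
      (use assms(1) in simp, (intro intertwining_matrix_entries[OF _ DX] intertwining_matrix_entries[OF _ DY]
        inverse_matrix_entries c inv; assumption)+)
  obtain z z' where z: "z \<in> intertwiners T\<^sub>1 T\<^sub>2" "z * z' = 1" "z' * z = 1"
    by (rule invertible_intertwiner)
  have monoid: "monoid (class_ring :: 'a ring)"
    by (rule ring.axioms(2)[OF class_ring.ring_axioms])
  have "inv\<^bsub>class_ring\<^esub> z = z'"
    by (rule monoid.inv_unique'[OF monoid, symmetric]) (use z in simp_all)
  moreover have "T\<^sub>2 = z' * T\<^sub>1 * z"
  proof -
    have "z' * T\<^sub>1 * z = z' * (z * T\<^sub>2)" using z(1) by (simp add: intertwiners_def mult.assoc)
    also have "\<dots> = (z' * z) * T\<^sub>2" by (simp only: mult.assoc)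
    finally show ?thesis using z(3) by simp
  qed
  moreover have "z \<in> Units class_ring" using z by (auto simp: Units_def)
  ultimately show ?thesis
    unfolding similar_in_def by (auto intro!: bexI[of _ z])
qed

end
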